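(* Let $(\alpha_q)_{q\ge1}$ be a sequence of algebraic integers such that, for all $q\ge1$, $|\alpha_q|>1$, $\mathrm M(\alpha_q)<1.176280\ldots$ (Lehmer's number), $\mathrm{dyg}(\alpha_q)\ge260$, and the minimal polynomial of $\alpha_q$ is not of the form $Q(X^r)$ with $r\ge2$ an integer and $Q\in\mathbb Z[X]$; assume $\lim_{q\to+\infty}\mathrm{house}(\alpha_q)=1$. Then the sequence $(\alpha_q)_{q\ge1}$ is strict and $\mu_{\alpha_q}\to\mu_{\mathbb T}$ weakly as $\mathrm{dyg}(\alpha_q)\to+\infty$, i.e. for all bounded continuous functions $f:\mathbb C^\times\to\mathbb C$, $$\int f\,d\mu_{\alpha_q}\to\int f\,d\mu_{\mathbb T},\qquad \mathrm{dyg}(\alpha_q)\to+\infty.$$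
   Context: $\mathrm M$ is the Mahler measure; $\mathrm{house}(\alpha)$ is the maximum modulus of the conjugates of $\alpha$. For $n\ge2$, $\theta_n$ is the unique root in $(0,1)$ of $-1+z+z^n$. For $1<\beta<\frac{1+\sqrt5}2$ real, $\mathrm{dyg}(\beta)$ is the unique integer $n\ge3$ with $\theta_n^{-1}\le\beta<\theta_{n-1}^{-1}$, $\mathrm{dyg}(\frac{1+\sqrt5}2)=2$, and $\mathrm{dyg}(\alpha):=\mathrm{dyg}(\mathrm{house}(\alpha))$ when $1<\mathrm{house}(\alpha)\le\frac{1+\sqrt5}{2}$. Lehmer's number is the largest real root of $X^{10}+X^9-X^7-X^6-X^5-X^4-X^3+X+1$. For $\alpha\in\overline{\mathbb Q}^\times$, $\mu_\alpha=\frac1{\deg\alpha}\sum_\sigma\delta_{\sigma(\alpha)}$, the sum being over all embeddings $\sigma:\mathbb Q(\alpha)\to\mathbb C$, and $\delta_\omega$ is the unit Dirac measure at $\omega$. $\mu_{\mathbb T}$ is the normalized Haar measure of the unit circle $\mathbb T$, viewed as a measure on $\mathbb C^\times$. A sequence in $\overline{\mathbb Q}^\times$ is strict if any proper algebraic subgroup of $\overline{\mathbb Q}^\times$ contains its $s$-th term for only finitely many $s$. *)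

theory Defs
  imports
    "HOL-Probability.Probability"
    "HOL-Algebra.Group"
    "Berlekamp_Zassenhaus.Mahler_Measure"
begin

text \<open>The minimal polynomial over \<open>\<int>\<close>: the irreducible (hence primitive) integer polynomial with
  positive leading coefficient that vanishes at \<open>\<alpha>\<close>. For an algebraic integer it is monic and
  coincides with the minimal polynomial over \<open>\<rat>\<close>; for a general algebraic number it is the
  polynomial that enters the Mahler measure.\<close>

definition min_zpoly :: "complex \<Rightarrow> int poly" where
  "min_zpoly \<alpha> = (THE p. Factorial_Ring.irreducible p \<and> lead_coeff p > 0 \<and> poly (map_poly of_int p) \<alpha> = 0)"

lemma zpoly_annihilators:
  fixes \<alpha> :: complex
  assumes "algebraic \<alpha>"
  obtains g :: "int poly" where "Factorial_Ring.irreducible g" "lead_coeff g > 0"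
    "\<And>f. poly (map_poly of_int f) \<alpha> = 0 \<longleftrightarrow> g dvd f"
proof -
  define V where "V = {f :: int poly. poly (map_poly of_int f) \<alpha> = 0}"
  have V_mult: "f * h \<in> V \<longleftrightarrow> f \<in> V \<or> h \<in> V" for f h
    by (simp add: V_def hom_distribs)
  have V_const: "[:c:] \<in> V \<longleftrightarrow> c = 0" for c
    by (cases "c = 0") (simp_all add: V_def map_poly_pCons)
  obtain p where "p \<in> V" "p \<noteq> 0"
    using assms by (auto elim: algebraicE' simp: V_def)
  then obtain g0 where g0: "g0 \<in> V" "g0 \<noteq> 0" and
      least: "\<And>f. f \<in> V \<Longrightarrow> f \<noteq> 0 \<Longrightarrow> degree g0 \<le> degree f"
    using ex_has_least_nat[of "\<lambda>f. f \<in> V \<and> f \<noteq> 0" p degree] by blast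
  define g1 where "g1 = primitive_part g0"
  have "g0 = [:content g0:] * g1"
    unfolding g1_def by simp
  then have "g1 \<in> V"
    using g0 V_mult V_const by (metis content_eq_zero_iff)
  then have g1: "g1 \<in> V" "g1 \<noteq> 0" "content g1 = 1" "degree g1 = degree g0"
    using g0 unfolding g1_def by auto
  define g where "g = Polynomial.smult (sgn (lead_coeff g1)) g1"
  have g_cases: "g = g1 \<and> lead_coeff g1 > 0 \<or> g = - g1 \<and> lead_coeff g1 < 0"
    using g1(2) by (cases "lead_coeff g1 > 0") (auto simp: g_def sgn_if)
  have "- g1 \<in> V"
    using V_mult[of "-1" g1] g1(1) by simp
  moreover have "content (- g1) = 1"
    using content_smult[of "-1" g1] g1(3) by simp
  ultimately have g: "g \<in> V" "g \<noteq> 0" "content g = 1" "degree g = degree g0" "lead_coeff g > 0"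
    using g1 g_cases by auto
  have dvd: "g dvd f" if f: "f \<in> V" for f
  proof -
    obtain a q where aq: "a \<noteq> 0" "Polynomial.smult a f = g * q + pseudo_mod f g"
      using pseudo_mod(1)[OF g(2)] by metis
    have "pseudo_mod f g = [:a:] * f - g * q"
      using aq(2) by simp
    then have "pseudo_mod f g \<in> V"
      using f g(1) by (simp add: V_def hom_distribs)
    moreover have "pseudo_mod f g = 0 \<or> degree (pseudo_mod f g) < degree g"
      using pseudo_mod(2)[OF g(2)] by metis
    ultimately have "pseudo_mod f g = 0"
      using least g(4) by fastforce
    then have "Polynomial.smult a f = g * q" using aq by simp
    then have "fract_poly g dvd Polynomial.smult (to_fract a) (fract_poly f)"
      by (metis dvd_triv_left fract_poly_dvd fract_poly_smult)
    then have "fract_poly g dvd fract_poly f"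
      using aq(1) by (simp add: dvd_smult_iff)
    then show "g dvd f"
      using fract_poly_dvdD g(3) by blast
  qed
  have "degree g \<noteq> 0"
  proof
    assume "degree g = 0"
    then obtain c where "g = [:c:]" by (metis degree_0_id)
    then show False using g V_const by auto
  qed
  then have "\<not> is_unit g"
    by (auto simp: is_unit_poly_iff)
  then have irr: "Factorial_Ring.irreducible g"
  proof (intro irreducibleI[OF g(2)])
    fix a b assume ab: "g = a * b"
    then have ne: "a \<noteq> 0" "b \<noteq> 0" using g(2) by auto
    have "a \<in> V \<or> b \<in> V" using ab g(1) V_mult by auto
    then have "g dvd a \<or> g dvd b" using dvd by auto
    then show "a dvd 1 \<or> b dvd 1"
      using ab ne dvd_times_left_cancel_iff[of a b 1] dvd_times_right_cancel_iff[of b a 1] by auto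
  qed
  have "f \<in> V \<longleftrightarrow> g dvd f" for f
    using dvd g(1) V_mult by (auto elim: dvdE)
  then show thesis
    using that[OF irr g(5)] by (auto simp: V_def)
qed

lemma min_zpoly_eqI:
  fixes \<alpha> :: complex
  assumes "Factorial_Ring.irreducible p" "lead_coeff p > 0" "poly (map_poly of_int p) \<alpha> = 0"
  shows "min_zpoly \<alpha> = p"
proof -
  have p0: "p \<noteq> 0" using assms(2) by auto
  have "algebraic \<alpha>"
    using assms(3) p0 by (intro algebraicI[of "map_poly of_int p"]) auto
  then obtain g where g: "Factorial_Ring.irreducible g" "lead_coeff g > 0"
    "\<And>f. poly (map_poly of_int f) \<alpha> = 0 \<longleftrightarrow> g dvd f"
    using zpoly_annihilators by blast
  have uniq: "f = g" if f: "Factorial_Ring.irreducible f" "lead_coeff f > 0"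
    "poly (map_poly of_int f) \<alpha> = 0" for f
  proof -
    obtain k where k: "f = g * k" using f(3) g(3) by auto
    then have "is_unit k" using f(1) g(1) by (auto simp: irreducible_def)
    then obtain c where c: "k = [:c:]" "is_unit c"
      by (auto simp: is_unit_poly_iff)
    moreover have "c > 0"
      using f(2) g(2) k c by (auto simp: zero_less_mult_iff split: if_splits)
    ultimately show ?thesis using k by simp
  qed
  show ?thesis
    unfolding min_zpoly_def using uniq assms by (intro the_equality) blast+
qed

lemma min_zpoly:
  fixes \<alpha> :: complex
  assumes "algebraic \<alpha>"
  shows "Factorial_Ring.irreducible (min_zpoly \<alpha>)" "lead_coeff (min_zpoly \<alpha>) > 0"
    "poly (map_poly of_int f) \<alpha> = 0 \<longleftrightarrow> min_zpoly \<alpha> dvd f"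
proof -
  obtain g where g: "Factorial_Ring.irreducible g" "lead_coeff g > 0"
    "\<And>f. poly (map_poly of_int f) \<alpha> = 0 \<longleftrightarrow> g dvd f"
    using zpoly_annihilators assms by blast
  then have "min_zpoly \<alpha> = g" by (intro min_zpoly_eqI) auto
  then show "Factorial_Ring.irreducible (min_zpoly \<alpha>)" "lead_coeff (min_zpoly \<alpha>) > 0"
    "poly (map_poly of_int f) \<alpha> = 0 \<longleftrightarrow> min_zpoly \<alpha> dvd f"
    using g by auto
qed

lemma min_zpoly_monic:
  fixes \<alpha> :: complex
  assumes "algebraic_int \<alpha>"
  shows "lead_coeff (min_zpoly \<alpha>) = 1"
proof -
  obtain p where p: "poly (map_poly of_int p) \<alpha> = 0" "lead_coeff p = 1"
    using assms by (auto simp: algebraic_int_altdef_ipoly)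
  have alg: "algebraic \<alpha>" using assms by auto
  obtain k where "p = min_zpoly \<alpha> * k"
    using p(1) min_zpoly(3)[OF alg] by auto
  then have "lead_coeff (min_zpoly \<alpha>) dvd 1"
    using p(2) by (metis dvd_triv_left lead_coeff_mult)
  then show ?thesis
    using min_zpoly(2)[OF alg] by simp
qed

definition alg_deg :: "complex \<Rightarrow> nat" where
  "alg_deg \<alpha> = degree (min_zpoly \<alpha>)"

definition conjugates :: "complex \<Rightarrow> complex set" where
  "conjugates \<alpha> = {z. poly (map_poly of_int (min_zpoly \<alpha>)) z = 0}"

definition house :: "complex \<Rightarrow> real" where
  "house \<alpha> = Max (cmod ` conjugates \<alpha>)"

definition mahler :: "complex \<Rightarrow> real" where
  "mahler \<alpha> = mahler_measure (min_zpoly \<alpha>)"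

definition lehmer_number :: real where
  "lehmer_number = Max {x. poly [:1, 1, 0, -1, -1, -1, -1, -1, 0, 1, 1:] x = 0}"

definition theta :: "nat \<Rightarrow> real" where
  "theta n = (THE z. 0 < z \<and> z < 1 \<and> -1 + z + z ^ n = 0)"

text \<open>Only meaningful for \<open>1 < \<beta> \<le> (1 + sqrt 5) / 2\<close>; unspecified elsewhere.\<close>

definition dyg_real :: "real \<Rightarrow> nat" where
  "dyg_real \<beta> =
     (if \<beta> = (1 + sqrt 5) / 2 then 2
      else (THE n. n \<ge> 3 \<and> inverse (theta n) \<le> \<beta> \<and> \<beta> < inverse (theta (n - 1))))"

definition dyg :: "complex \<Rightarrow> nat" where
  "dyg \<alpha> = dyg_real (house \<alpha>)"

definition Qbar_units :: "complex monoid" where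
  "Qbar_units = \<lparr>carrier = {z. algebraic z \<and> z \<noteq> 0}, monoid.mult = (*), one = 1\<rparr>"

text \<open>Zariski closed subsets of \<open>\<G>\<^sub>m\<close> are cut out by Laurent polynomials; multiplying by a power of
  the (invertible) coordinate, ordinary polynomials suffice.\<close>

definition algebraic_subgroup :: "complex set \<Rightarrow> bool" where
  "algebraic_subgroup H \<longleftrightarrow>
     subgroup H Qbar_units \<and>
     (\<exists>P :: complex poly set. (\<forall>p\<in>P. \<forall>i. algebraic (Polynomial.coeff p i)) \<and>
        H = {z \<in> carrier Qbar_units. \<forall>p\<in>P. poly p z = 0})"

text \<open>Sequences are indexed by \<open>q \<ge> 1\<close>; the value at \<open>0\<close> is ignored.\<close>

definition strict_sequence :: "(nat \<Rightarrow> complex) \<Rightarrow> bool" where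
  "strict_sequence a \<longleftrightarrow>
     (\<forall>q\<ge>1. a q \<in> carrier Qbar_units) \<and>
     (\<forall>H. algebraic_subgroup H \<and> H \<noteq> carrier Qbar_units \<longrightarrow> finite {q. q \<ge> 1 \<and> a q \<in> H})"

definition is_subfield :: "complex set \<Rightarrow> bool" where
  "is_subfield K \<longleftrightarrow>
     0 \<in> K \<and> 1 \<in> K \<and>
     (\<forall>x\<in>K. \<forall>y\<in>K. x + y \<in> K \<and> x * y \<in> K) \<and>
     (\<forall>x\<in>K. - x \<in> K \<and> inverse x \<in> K)"

definition Q_adjoin :: "complex \<Rightarrow> complex set" where
  "Q_adjoin \<alpha> = \<Inter>{K. is_subfield K \<and> \<alpha> \<in> K}"

text \<open>Extensionality makes distinct elements of this set distinct as maps on \<open>\<rat>(\<alpha>)\<close>.\<close>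

definition embeddings :: "complex \<Rightarrow> (complex \<Rightarrow> complex) set" where
  "embeddings \<alpha> =
     {\<sigma> \<in> extensional (Q_adjoin \<alpha>).
        \<sigma> 1 = 1 \<and>
        (\<forall>x\<in>Q_adjoin \<alpha>. \<forall>y\<in>Q_adjoin \<alpha>. \<sigma> (x + y) = \<sigma> x + \<sigma> y \<and> \<sigma> (x * y) = \<sigma> x * \<sigma> y)}"

abbreviation punctured_plane :: "complex measure" where
  "punctured_plane \<equiv> restrict_space borel (- {0})"

definition conj_measure :: "complex \<Rightarrow> complex measure" where
  "conj_measure \<alpha> =
     measure_of (space punctured_plane) (sets punctured_plane)
       (\<lambda>A. ennreal (1 / real (alg_deg \<alpha>)) *
             (\<Sum>\<sigma>\<in>embeddings \<alpha>. emeasure (return punctured_plane (\<sigma> \<alpha>)) A))"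

text \<open>Normalized Lebesgue measure transported to the unit circle; the facts below identify it as the
  rotation-invariant Borel probability measure concentrated there.\<close>

definition circle_haar :: "complex measure" where
  "circle_haar = distr (uniform_measure lborel {0..<1}) punctured_plane (\<lambda>t. cis (2 * pi * t))"

lemma cis_measurable_punctured [measurable]:
  "(\<lambda>t. cis (2 * pi * t)) \<in> measurable borel punctured_plane"
proof (rule measurable_restrict_space2)
  show "(\<lambda>t::real. cis (2 * pi * t)) \<in> borel_measurable borel"
    by (intro borel_measurable_continuous_onI continuous_intros)
qed auto

lemma emeasure_circle_haar:
  assumes "A \<in> sets punctured_plane"
  shows "emeasure circle_haar A = emeasure lborel ({0..<1} \<inter> {t. cis (2 * pi * t) \<in> A})"
proof -
  have "{t. cis (2 * pi * t) \<in> A} \<in> sets borel"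
    using measurable_sets[OF cis_measurable_punctured assms] by (simp add: vimage_def)
  then show ?thesis
    unfolding circle_haar_def using assms
    by (subst emeasure_distr)
       (auto simp: vimage_def divide_ennreal_def measurable_def[of "uniform_measure _ _"]
             intro!: measurable_sets[OF cis_measurable_punctured, simplified vimage_def, simplified])
qed

lemma circle_haar_concentrated: "emeasure circle_haar (sphere 0 1) = 1"
proof -
  have "sphere (0::complex) 1 \<in> sets punctured_plane"
    by (subst sets_restrict_space_iff) auto
  then show ?thesis
    by (simp add: emeasure_circle_haar)
qed

lemma circle_haar_rotation:
  assumes "cmod u = 1"
  shows "distr circle_haar punctured_plane ((*) u) = circle_haar"
proof (rule measure_eqI)
  obtain s0 where s0: "u = cis s0"
    using assms by (metis complex_norm_eq_1_exp cis_conv_exp)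
  define s where "s = frac (s0 / (2 * pi))"
  have s: "0 \<le> s" "s < 1" unfolding s_def by (auto simp: frac_lt_1)
  have per: "cis (2 * pi * (t + of_int k)) = cis (2 * pi * t)" for t k
    by (simp add: distrib_left flip: cis_mult)
  have us: "u = cis (2 * pi * s)"
    using per[of s "\<lfloor>s0 / (2 * pi)\<rfloor>"] unfolding s0 s_def frac_def by simp
  fix A assume "A \<in> sets (distr circle_haar punctured_plane ((*) u))"
  then have A: "A \<in> sets punctured_plane" by simp
  have u0: "u \<noteq> 0" using assms by auto
  have m: "((*) u) \<in> measurable punctured_plane punctured_plane"
    using u0 by (intro measurable_restrict_space2 measurable_restrict_space1) (auto simp: space_restrict_space)
  have m': "((*) u) \<in> measurable circle_haar punctured_plane"
    using m unfolding circle_haar_def by (simp cong: measurable_cong_sets)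
  have B: "((*) u) -` A \<inter> - {0} \<in> sets punctured_plane"
    using measurable_sets[OF m A] by (simp add: space_restrict_space)
  define C where "C = {t. cis (2 * pi * t) \<in> A}"
  have C [measurable]: "C \<in> sets borel"
    using measurable_sets[OF cis_measurable_punctured A] by (simp add: vimage_def C_def)
  have shift: "emeasure lborel {t. t + c \<in> D} = emeasure lborel D" if "D \<in> sets borel" for c and D :: "real set"
  proof -
    have "emeasure lborel D = emeasure (distr lborel borel ((+) c)) D"
      using lborel_distr_plus[of c] by simp
    also have "\<dots> = emeasure lborel {t. t + c \<in> D}"
      using that by (subst emeasure_distr) (auto simp: vimage_def add.commute)
    finally show ?thesis by simp
  qed
  have C1: "t + 1 \<in> C \<longleftrightarrow> t \<in> C" for t
    using per[of t 1] by (simp add: C_def)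
  have "emeasure (distr circle_haar punctured_plane ((*) u)) A
      = emeasure circle_haar (((*) u) -` A \<inter> - {0})"
    using m' A by (simp add: emeasure_distr circle_haar_def space_restrict_space)
  also have "\<dots> = emeasure lborel ({0..<1} \<inter> {t. cis (2 * pi * t) \<in> ((*) u) -` A \<inter> - {0}})"
    by (rule emeasure_circle_haar[OF B])
  also have "{0..<1} \<inter> {t. cis (2 * pi * t) \<in> ((*) u) -` A \<inter> - {0}} = {t. t + s \<in> {s..<s+1} \<inter> C}"
    by (auto simp: us C_def cis_mult algebra_simps)
  also have "emeasure lborel \<dots> = emeasure lborel ({s..<s+1} \<inter> C)"
    by (rule shift) auto
  also have "{s..<s+1} \<inter> C = ({s..<1} \<inter> C) \<union> ({1..<s+1} \<inter> C)"
    using s by auto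
  also have "emeasure lborel \<dots> = emeasure lborel ({s..<1} \<inter> C) + emeasure lborel ({1..<s+1} \<inter> C)"
    by (intro plus_emeasure[symmetric]) auto
  also have "emeasure lborel ({1..<s+1} \<inter> C) = emeasure lborel {t. t + 1 \<in> {1..<s+1} \<inter> C}"
    by (rule shift[symmetric]) auto
  also have "{t. t + 1 \<in> {1..<s+1} \<inter> C} = {0..<s} \<inter> C"
    using C1 by auto
  also have "emeasure lborel ({s..<1} \<inter> C) + emeasure lborel ({0..<s} \<inter> C)
      = emeasure lborel (({s..<1} \<inter> C) \<union> ({0..<s} \<inter> C))"
    by (intro plus_emeasure) auto
  also have "({s..<1} \<inter> C) \<union> ({0..<s} \<inter> C) = {0..<1} \<inter> C"
    using s by auto
  also have "emeasure lborel \<dots> = emeasure circle_haar A"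
    by (simp add: emeasure_circle_haar[OF A] C_def)
  finally show "emeasure (distr circle_haar punctured_plane ((*) u)) A = emeasure circle_haar A" .
qed (simp add: circle_haar_def)

end

theory Submission
  imports Defs "Berlekamp_Zassenhaus.Factor_Bound" "HOL-Real_Asymp.Real_Asymp"
begin

text \<open>A proper algebraic subgroup consists of roots of unity, so it contains no \<open>\<alpha>\<^sub>q\<close> at all. Since there are
  finitely many integer polynomials of bounded degree and Mahler measure, \<open>house \<alpha>\<^sub>q \<rightarrow> 1\<close> with
  \<open>house \<alpha>\<^sub>q > 1\<close> forces the degree \<open>n\<close> to infinity.

  For the equidistribution, scale the conjugates by \<open>R = house \<alpha>\<^sub>q\<close> into the unit disc. There
  \<open>\<bar>z - w\<bar> \<le> 2 / (1 + r) \<sqdot> \<bar>1 - r z w\<^sup>*\<bar>\<close> for \<open>r < 1\<close> (with \<open>w\<^sup>*\<close> the complex conjugate), and the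
  logarithm of the right-hand side, summed over all pairs, is a constant minus \<open>\<Sum>\<^sub>m r\<^sup>m / m \<sqdot> \<bar>S\<^sub>m\<bar>\<^sup>2\<close>,
  where \<open>S\<^sub>m\<close> is the \<open>m\<close>-th power sum. The discriminant is a nonzero integer, so the sum over pairs
  of \<open>ln \<bar>z - w\<bar>\<close> is nonnegative before scaling; with \<open>r = n / (n + 1)\<close> this gives \<open>S\<^sub>m / n \<rightarrow> 0\<close> for every
  \<open>m \<ge> 1\<close>. The norm of \<open>\<alpha>\<^sub>q\<close> is a nonzero integer too, so the mean of \<open>ln (R / \<bar>z\<bar>)\<close> is at most \<open>ln R\<close>,
  which makes the conjugates accumulate at the unit circle. Weierstrass approximation by trigonometric
  polynomials concludes.\<close>

section \<open>Norms and discriminants of algebraic integers\<close>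

text \<open>A kernel vector of the transpose holds the coefficients of a polynomial of degree below
  \<open>n\<close> that vanishes at \<open>n\<close> distinct points, so it is zero.\<close>

lemma det_vandermonde_nonzero:
  fixes zs :: "'a::field list"
  assumes "distinct zs"
  defines "n \<equiv> length zs"
  shows "Determinant.det (mat n n (\<lambda>(j, k). (zs ! k) ^ j)) \<noteq> 0"
proof
  let ?V = "mat n n (\<lambda>(j, k). (zs ! k) ^ j)"
  assume "Determinant.det ?V = 0"
  moreover have V: "?V \<in> carrier_mat n n" by simp
  ultimately have "Determinant.det (transpose_mat ?V) = 0"
    using det_transpose[OF V] by simp
  moreover have "transpose_mat ?V \<in> carrier_mat n n" by simp
  ultimately obtain v where v: "v \<in> carrier_vec n" "v \<noteq> 0\<^sub>v n" "transpose_mat ?V *\<^sub>v v = 0\<^sub>v n"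
    using det_0_iff_vec_prod_zero by blast
  define P where "P = (\<Sum>j<n. Polynomial.monom (v $ j) j)"
  have coeffP: "Polynomial.coeff P j = (if j < n then v $ j else 0)" for j
    by (simp add: P_def Polynomial.coeff_sum sum.If_cases if_distrib cong: if_cong)
  have "poly P (zs ! k) = 0" if "k < n" for k
  proof -
    have "poly P (zs ! k) = (\<Sum>j<n. (zs ! k) ^ j * v $ j)"
      by (simp add: P_def poly_sum poly_monom mult.commute)
    also have "\<dots> = (transpose_mat ?V *\<^sub>v v) $ k"
      using that v(1) by (auto simp: scalar_prod_def lessThan_atLeast0 intro!: sum.cong)
    finally show ?thesis using v(3) that by simp
  qed
  then have sub: "set zs \<subseteq> {x. poly P x = 0}"
    by (auto simp: in_set_conv_nth n_def)
  have "P = 0"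
  proof (rule ccontr)
    assume P0: "P \<noteq> 0"
    have "n = card (set zs)"
      using assms by (simp add: distinct_card)
    also have "\<dots> \<le> card {x. poly P x = 0}"
      using sub P0 by (intro card_mono poly_roots_finite)
    also have "\<dots> \<le> Polynomial.degree P"
      using P0 by (rule card_poly_roots_bound)
    also have "\<dots> < n"
      using P0 coeffP[of "Polynomial.degree P"] by (metis leading_coeff_0_iff)
    finally show False by simp
  qed
  then have "v = 0\<^sub>v n"
    using coeffP v(1) by (intro eq_vecI) (metis coeff_0 carrier_vecD index_zero_vec(1,2))+
  with v(2) show False by simp
qed

text \<open>The product is the determinant of multiplication by \<open>q\<close> on \<open>\<int>[X]/(p)\<close>, because the
  Vandermonde matrix of the roots diagonalises that multiplication.\<close>

lemma prod_poly_roots_in_Ints: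
  fixes p q :: "int poly" and Z :: "complex set"
  assumes fin: "finite Z" and p: "map_poly of_int p = (\<Prod>z\<in>Z. [:- z, 1:])"
  shows "(\<Prod>z\<in>Z. poly (map_poly of_int q) z) \<in> \<int>"
proof -
  obtain zs where zs: "set zs = Z" "distinct zs"
    using finite_distinct_list[OF fin] by blast
  define n where "n = length zs"
  have nth: "zs ! k \<in> Z" if "k < n" for k
    using that zs(1) n_def by force
  have "Polynomial.lead_coeff (map_poly complex_of_int p) = 1"
    unfolding p by (simp add: Polynomial.lead_coeff_prod)
  then have monic: "Polynomial.lead_coeff p = 1" by simp
  then have p0: "p \<noteq> 0" by auto
  have "Polynomial.degree (map_poly complex_of_int p) = n"
    unfolding p using zs by (subst degree_prod_eq_sum_degree) (auto simp: n_def distinct_card)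
  then have deg: "Polynomial.degree p = n" by simp
  have root: "poly (map_poly of_int p) z = 0" if "z \<in> Z" for z :: complex
    unfolding p using that fin by (auto simp: poly_prod)
  \<comment> \<open>Since \<open>p\<close> is monic, pseudo-division is division with remainder over
    the integers, so the matrix \<open>A\<close> built from these remainders is integral.\<close>
  define r where "r i = snd (pseudo_divmod (Polynomial.monom 1 i * q) p)" for i
  define s where "s i = fst (pseudo_divmod (Polynomial.monom 1 i * q) p)" for i
  have rs: "Polynomial.monom 1 i * q = p * s i + r i" "r i = 0 \<or> Polynomial.degree (r i) < n" for i
    using pseudo_divmod[OF p0, of "Polynomial.monom 1 i * q" "s i" "r i"] monic deg
    by (auto simp: r_def s_def)
  have coeff_r: "Polynomial.coeff (r i) j = 0" if "j \<ge> n" for i j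
    using rs(2)[of i] that by (auto intro: coeff_eq_0)
  have eval: "z ^ i * poly (map_poly of_int q) z = (\<Sum>j<n. of_int (Polynomial.coeff (r i) j) * z ^ j)"
    if "z \<in> Z" for z i
  proof -
    have "z ^ i * poly (map_poly of_int q) z = poly (map_poly of_int (Polynomial.monom 1 i * q)) z"
      by (simp add: hom_distribs poly_monom)
    also have "\<dots> = poly (map_poly of_int (r i)) z"
      using root[OF that] by (simp add: rs(1) hom_distribs)
    also have "\<dots> = (\<Sum>j\<le>Polynomial.degree (r i). of_int (Polynomial.coeff (r i) j) * z ^ j)"
      by (simp add: poly_altdef)
    also have "\<dots> = (\<Sum>j<n. of_int (Polynomial.coeff (r i) j) * z ^ j)"
      using rs(2)[of i] coeff_r[of _ i]
      by (intro sum.mono_neutral_cong) (auto simp: coeff_eq_0 not_less)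
    finally show ?thesis .
  qed
  define A where "A = mat n n (\<lambda>(i, j). Polynomial.coeff (r i) j)"
  define V where "V = mat n n (\<lambda>(j, k). (zs ! k) ^ j)"
  define D where "D = mat n n (\<lambda>(k, l). if k = l then poly (map_poly of_int q) (zs ! k) else 0)"
  have carr: "map_mat complex_of_int A \<in> carrier_mat n n" "V \<in> carrier_mat n n" "D \<in> carrier_mat n n"
    by (auto simp: A_def V_def D_def)
  \<comment> \<open>Entry \<open>(i, k)\<close> of both sides is the value of \<open>X^i * q\<close>
    at the \<open>k\<close>-th root: reduction modulo \<open>p\<close> does not change values at
    roots of \<open>p\<close>.\<close>
  have "map_mat complex_of_int A * V = V * D"
  proof (rule eq_matI)
    fix i k assume "i < dim_row (V * D)" "k < dim_col (V * D)"
    then have ik: "i < n" "k < n" by (auto simp: V_def D_def)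
    have "(map_mat complex_of_int A * V) $$ (i, k)
        = (\<Sum>j<n. of_int (Polynomial.coeff (r i) j) * (zs ! k) ^ j)"
      using ik by (auto simp: A_def V_def scalar_prod_def lessThan_atLeast0 intro!: sum.cong)
    also have "\<dots> = (zs ! k) ^ i * poly (map_poly of_int q) (zs ! k)"
      using eval nth ik by simp
    also have "\<dots> = (\<Sum>j<n. (zs ! j) ^ i * (if j = k then poly (map_poly of_int q) (zs ! j) else 0))"
      using ik by (simp add: if_distrib[of "\<lambda>x. _ * x"] cong: if_cong)
    also have "\<dots> = (V * D) $$ (i, k)"
      using ik by (auto simp: D_def V_def scalar_prod_def lessThan_atLeast0 intro!: sum.cong)
    finally show "(map_mat complex_of_int A * V) $$ (i, k) = (V * D) $$ (i, k)" .
  qed (auto simp: A_def V_def D_def)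
  then have "Determinant.det (map_mat complex_of_int A) * Determinant.det V
      = Determinant.det V * Determinant.det D"
    using det_mult[OF carr(1,2)] det_mult[OF carr(2,3)] by metis
  moreover have "Determinant.det V \<noteq> 0"
    using det_vandermonde_nonzero[OF zs(2)] by (simp add: V_def n_def)
  ultimately have "Determinant.det D = Determinant.det (map_mat complex_of_int A)"
    by simp
  also have "\<dots> = of_int (Determinant.det A)"
    by (rule of_int_hom.hom_det)
  finally have "Determinant.det D \<in> \<int>" by simp
  moreover have "Determinant.det D = (\<Prod>k<n. poly (map_poly of_int q) (zs ! k))"
    by (subst det_upper_triangular[OF _ carr(3)])
       (auto simp: D_def prod_list_diag_prod lessThan_atLeast0 intro!: prod.cong)
  also have "\<dots> = (\<Prod>z\<in>Z. poly (map_poly of_int q) z)"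
    using zs by (intro prod.reindex_bij_betw) (auto simp: n_def intro!: bij_betw_nth)
  ultimately show ?thesis by simp
qed

text \<open>A nonzero integer has absolute value at least 1. Taking \<open>q\<close> to be X bounds
  the norm; taking \<open>q\<close> to be the derivative of \<open>p\<close> bounds the
  discriminant.\<close>

lemma norm_prod_poly_roots_ge_1:
  fixes p q :: "int poly" and Z :: "complex set"
  assumes "finite Z" "map_poly of_int p = (\<Prod>z\<in>Z. [:- z, 1:])"
    and "\<And>z. z \<in> Z \<Longrightarrow> poly (map_poly of_int q) z \<noteq> 0"
  shows "(\<Prod>z\<in>Z. cmod (poly (map_poly of_int q) z)) \<ge> 1"
proof -
  obtain k where k: "(\<Prod>z\<in>Z. poly (map_poly of_int q) z) = complex_of_int k"
    using prod_poly_roots_in_Ints[OF assms(1,2)] by (auto elim: Ints_cases)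
  moreover have "(\<Prod>z\<in>Z. poly (map_poly of_int q) z) \<noteq> 0"
    using assms(1,3) by simp
  ultimately have "k \<noteq> 0" by auto
  then have "\<bar>k\<bar> \<ge> 1" by linarith
  then have "cmod (\<Prod>z\<in>Z. poly (map_poly of_int q) z) \<ge> 1"
    using k by (simp flip: of_int_abs)
  then show ?thesis
    by (simp add: prod_norm)
qed

section \<open>Conjugates as the roots of the minimal polynomial\<close>

lemma min_zpoly_conjugate:
  assumes "algebraic \<alpha>" "z \<in> conjugates \<alpha>"
  shows "min_zpoly z = min_zpoly \<alpha>"
  using min_zpoly(1,2)[OF assms(1)] assms(2) by (intro min_zpoly_eqI) (auto simp: conjugates_def)

lemma algebraic_conjugate:
  assumes "algebraic \<alpha>" "z \<in> conjugates \<alpha>"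
  shows "algebraic z"
  using min_zpoly(2)[OF assms(1)] assms(2)
  by (intro algebraicI[of "map_poly of_int (min_zpoly \<alpha>)"]) (auto simp: conjugates_def)

lemma conjugate_self: "algebraic \<alpha> \<Longrightarrow> \<alpha> \<in> conjugates \<alpha>"
  by (simp add: conjugates_def min_zpoly(3))

text \<open>Conjugates share their minimal polynomial, whose multiples are exactly the integer
  polynomials vanishing there. This transfers nonvanishing between conjugates and later makes the
  embeddings well defined.\<close>

lemma poly_conjugate_eq_0_iff:
  assumes "algebraic \<alpha>" "z \<in> conjugates \<alpha>"
  shows "poly (map_poly of_int f) z = 0 \<longleftrightarrow> poly (map_poly of_int f) \<alpha> = 0"
  using min_zpoly(3)[OF assms(1)] min_zpoly(3)[OF algebraic_conjugate[OF assms]]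
  by (simp add: min_zpoly_conjugate[OF assms])

lemma finite_conjugates:
  assumes "algebraic \<alpha>"
  shows "finite (conjugates \<alpha>)"
proof -
  have "map_poly complex_of_int (min_zpoly \<alpha>) \<noteq> 0"
    using min_zpoly(2)[OF assms] by auto
  then show ?thesis
    unfolding conjugates_def by (rule poly_roots_finite)
qed

lemma alg_deg_pos:
  assumes "algebraic \<alpha>"
  shows "alg_deg \<alpha> > 0"
proof (rule ccontr)
  assume "\<not> alg_deg \<alpha> > 0"
  then obtain c where c: "min_zpoly \<alpha> = [:c:]"
    unfolding alg_deg_def by (metis degree_0_id not_gr_zero)
  then show False
    using min_zpoly(2)[OF assms] min_zpoly(3)[OF assms, of "min_zpoly \<alpha>"]
    by (simp add: map_poly_pCons split: if_splits)
qed

text \<open>Otherwise the minimal polynomial would divide its derivative, which is nonzero in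
  characteristic 0 and has smaller degree.\<close>

lemma poly_pderiv_min_zpoly_nonzero:
  assumes "algebraic \<alpha>" "z \<in> conjugates \<alpha>"
  shows "poly (map_poly of_int (pderiv (min_zpoly \<alpha>))) z \<noteq> 0"
proof
  assume "poly (map_poly of_int (pderiv (min_zpoly \<alpha>))) z = 0"
  then have "min_zpoly \<alpha> dvd pderiv (min_zpoly \<alpha>)"
    using min_zpoly(3)[OF assms(1)] by (simp add: poly_conjugate_eq_0_iff[OF assms])
  moreover have "pderiv (min_zpoly \<alpha>) \<noteq> 0"
    using alg_deg_pos[OF assms(1)] by (simp add: pderiv_eq_0_iff alg_deg_def)
  ultimately have "Polynomial.degree (min_zpoly \<alpha>) \<le> Polynomial.degree (pderiv (min_zpoly \<alpha>))"
    by (rule dvd_imp_degree_le)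
  then show False
    using alg_deg_pos[OF assms(1)] by (simp add: degree_pderiv alg_deg_def)
qed

text \<open>The roots are simple by the previous lemma, and integrality of \<alpha> makes the
  leading coefficient 1.\<close>

lemma min_zpoly_eq_prod:
  assumes "algebraic_int \<alpha>"
  shows "map_poly of_int (min_zpoly \<alpha>) = (\<Prod>z\<in>conjugates \<alpha>. [:- z, 1:])"
proof -
  have alg: "algebraic \<alpha>" using assms by auto
  have "rsquarefree (map_poly complex_of_int (min_zpoly \<alpha>))"
    using poly_pderiv_min_zpoly_nonzero[OF alg]
    by (auto simp: rsquarefree_roots conjugates_def of_int_hom.map_poly_pderiv)
  from complex_poly_decompose_rsquarefree[OF this] show ?thesis
    using min_zpoly_monic[OF assms] by (simp add: conjugates_def)
qed

lemma card_conjugates: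
  assumes "algebraic_int \<alpha>"
  shows "card (conjugates \<alpha>) = alg_deg \<alpha>"
proof -
  have "alg_deg \<alpha> = Polynomial.degree (map_poly complex_of_int (min_zpoly \<alpha>))"
    by (simp add: alg_deg_def)
  also have "\<dots> = card (conjugates \<alpha>)"
    unfolding min_zpoly_eq_prod[OF assms] by (subst degree_prod_eq_sum_degree) auto
  finally show ?thesis ..
qed

text \<open>The polynomial X vanishes at one conjugate exactly when it vanishes at \<alpha>.\<close>

lemma conjugate_nonzero:
  assumes "algebraic \<alpha>" "\<alpha> \<noteq> 0" "z \<in> conjugates \<alpha>"
  shows "z \<noteq> 0"
  using poly_conjugate_eq_0_iff[OF assms(1,3), of "[:0, 1:]"] assms(2) by (auto simp: map_poly_pCons)

text \<open>The product of the conjugates is a nonzero integer, up to sign the constant coefficient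
  of the minimal polynomial.\<close>

lemma sum_ln_norm_conjugates_nonneg:
  assumes "algebraic_int \<alpha>" "\<alpha> \<noteq> 0"
  shows "(\<Sum>z\<in>conjugates \<alpha>. ln (cmod z)) \<ge> 0"
proof -
  have alg: "algebraic \<alpha>" using assms by auto
  note nz = conjugate_nonzero[OF alg assms(2)]
  have "(\<Prod>z\<in>conjugates \<alpha>. cmod z) \<ge> 1"
    using norm_prod_poly_roots_ge_1[OF finite_conjugates[OF alg] min_zpoly_eq_prod[OF assms(1)], of "[:0, 1:]"] nz
    by (simp add: map_poly_pCons)
  then have "ln (\<Prod>z\<in>conjugates \<alpha>. cmod z) \<ge> 0" by simp
  then show ?thesis
    using nz by (subst (asm) ln_prod) (auto simp: finite_conjugates[OF alg])
qed

text \<open>The product of the differences is the norm of \<open>p'(\<alpha>)\<close>, up to sign the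
  discriminant of \<open>p\<close>.\<close>

lemma sum_ln_dist_conjugates_nonneg:
  assumes "algebraic_int \<alpha>"
  shows "(\<Sum>z\<in>conjugates \<alpha>. \<Sum>w\<in>conjugates \<alpha> - {z}. ln (cmod (z - w))) \<ge> 0"
proof -
  have alg: "algebraic \<alpha>" using assms by auto
  let ?Z = "conjugates \<alpha>" and ?p = "min_zpoly \<alpha>"
  have fin: "finite ?Z" by (rule finite_conjugates[OF alg])
  have deriv: "poly (map_poly of_int (pderiv ?p)) z = (\<Prod>w\<in>?Z - {z}. z - w)" if z: "z \<in> ?Z" for z
  proof -
    \<comment> \<open>With the factor X - z split off, the term of the product rule that keeps this
      factor vanishes at \<open>z\<close>.\<close>
    have "map_poly of_int ?p = [:- z, 1:] * (\<Prod>w\<in>?Z - {z}. [:- w, 1:])"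
      unfolding min_zpoly_eq_prod[OF assms] using fin z by (rule prod.remove)
    then have "pderiv (map_poly of_int ?p) = [:- z, 1:] * pderiv (\<Prod>w\<in>?Z - {z}. [:- w, 1:])
        + (\<Prod>w\<in>?Z - {z}. [:- w, 1:]) * pderiv [:- z, 1:]"
      by (simp only: pderiv_mult)
    then have "poly (pderiv (map_poly of_int ?p)) z = (\<Prod>w\<in>?Z - {z}. z - w)"
      by (simp add: poly_prod pderiv_pCons)
    then show ?thesis
      by (simp add: of_int_hom.map_poly_pderiv)
  qed
  have "1 \<le> (\<Prod>z\<in>?Z. cmod (poly (map_poly of_int (pderiv ?p)) z))"
    by (intro norm_prod_poly_roots_ge_1[OF fin min_zpoly_eq_prod[OF assms]]
          poly_pderiv_min_zpoly_nonzero[OF alg])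
  also have "\<dots> = (\<Prod>z\<in>?Z. \<Prod>w\<in>?Z - {z}. cmod (z - w))"
    using deriv by (simp add: prod_norm)
  finally have "0 \<le> ln (\<Prod>z\<in>?Z. \<Prod>w\<in>?Z - {z}. cmod (z - w))" by simp
  also have "\<dots> = (\<Sum>z\<in>?Z. ln (\<Prod>w\<in>?Z - {z}. cmod (z - w)))"
    using fin by (subst ln_prod) (auto intro!: prod_pos)
  also have "\<dots> = (\<Sum>z\<in>?Z. \<Sum>w\<in>?Z - {z}. ln (cmod (z - w)))"
    using fin by (intro sum.cong refl ln_prod) auto
  finally show ?thesis .
qed

text \<open>Northcott finiteness: Mignotte's bound controls every coefficient by a binomial
  coefficient times the Mahler measure, so only finitely many coefficient lists remain.\<close>

lemma finite_int_poly_mahler_bounded: "finite {p :: int poly. Polynomial.degree p \<le> d \<and> mahler_measure p \<le> B}"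
proof (rule finite_subset)
  define C where "C = \<lceil>2 ^ d * max 0 B\<rceil>"
  define S where "S = {xs. set xs \<subseteq> {-C..C} \<and> length xs \<le> Suc d}"
  show "finite (Poly ` S)"
    unfolding S_def by (intro finite_imageI finite_lists_length_le) auto
  show "{p :: int poly. Polynomial.degree p \<le> d \<and> mahler_measure p \<le> B} \<subseteq> Poly ` S"
  proof clarify
    fix p :: "int poly" assume p: "Polynomial.degree p \<le> d" "mahler_measure p \<le> B"
    have bound: "\<bar>Polynomial.coeff p k\<bar> \<le> C" for k
    proof -
      have "real_of_int \<bar>Polynomial.coeff p k\<bar> \<le> (Polynomial.degree p choose k) * mahler_measure p"
        by (rule Mignotte_bound)
      also have "(Polynomial.degree p choose k) \<le> 2 ^ Polynomial.degree p"
        by (rule binomial_le_pow2)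
      also have "(2::nat) ^ Polynomial.degree p \<le> 2 ^ d"
        using p(1) by (simp add: power_increasing)
      also have "real (2 ^ d) * mahler_measure p \<le> 2 ^ d * max 0 B"
        using p(2) by simp
      finally show ?thesis
        using mahler_measure_ge_0[of p] unfolding C_def by (simp add: mult_right_mono) linarith
    qed
    have "set (coeffs p) \<subseteq> {-C..C}"
      using bound by (auto simp: in_set_conv_nth nth_coeffs_coeff length_coeffs abs_le_iff minus_le_iff)
    moreover have "length (coeffs p) \<le> Suc d"
      using p(1) by (cases "p = 0") (auto simp: length_coeffs)
    ultimately have "coeffs p \<in> S"
      by (simp add: S_def)
    then show "p \<in> Poly ` S"
      by (metis Poly_coeffs imageI)
  qed
qed

section \<open>Power sums and logarithmic energy\<close>

text \<open>The difference of the squares factors as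
  \<open>(1 - |z|^2) * (1 - |w|^2)\<close>.\<close>

lemma norm_diff_le_norm_one_minus_cnj:
  fixes z w :: complex
  assumes "cmod z \<le> 1" "cmod w \<le> 1"
  shows "cmod (z - w) \<le> cmod (1 - z * cnj w)"
proof -
  have "(cmod (1 - z * cnj w))\<^sup>2 - (cmod (z - w))\<^sup>2 = (1 - (cmod z)\<^sup>2) * (1 - (cmod w)\<^sup>2)"
    by (simp add: cmod_power2) Groebner_Basis.algebra
  also have "\<dots> \<ge> 0"
    using assms by (intro mult_nonneg_nonneg) (simp_all add: power_le_one)
  finally have "(cmod (z - w))\<^sup>2 \<le> (cmod (1 - z * cnj w))\<^sup>2"
    by linarith
  then show ?thesis
    by (rule power2_le_imp_le) simp
qed

text \<open>The difference of the squares is a sum of two nonnegative terms. The factor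
  \<open>r\<close> moves \<open>u\<close> into the open disc, where the logarithmic series
  converges; the price is the constant \<open>2 / (1 + r)\<close>, which tends to 1 with
  \<open>r\<close>.\<close>

lemma norm_one_minus_le_scaled:
  fixes u :: complex and r :: real
  assumes "cmod u \<le> 1" "0 \<le> r" "r \<le> 1"
  shows "(1 + r) * cmod (1 - u) \<le> 2 * cmod (1 - of_real r * u)"
proof -
  have "(2 * cmod (1 - of_real r * u))\<^sup>2 - ((1 + r) * cmod (1 - u))\<^sup>2
      = ((1 - r) * cmod (1 + u))\<^sup>2 + 2 * (1 - r) * (1 + r) * (1 - (cmod u)\<^sup>2)"
    by (simp add: cmod_power2 power_mult_distrib) Groebner_Basis.algebra
  also have "\<dots> \<ge> 0"
    using assms by (intro add_nonneg_nonneg mult_nonneg_nonneg) (simp_all add: power_le_one)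
  finally have "((1 + r) * cmod (1 - u))\<^sup>2 \<le> (2 * cmod (1 - of_real r * u))\<^sup>2"
    by linarith
  then show ?thesis
    by (rule power2_le_imp_le) simp
qed

text \<open>Chains the two inequalities at \<open>u = z * cnj w\<close>; \<open>r < 1\<close> keeps
  the argument of the last logarithm positive.\<close>

lemma ln_norm_diff_le:
  fixes z w :: complex
  assumes "cmod z \<le> 1" "cmod w \<le> 1" "z \<noteq> w" "0 < r" "r < 1"
  shows "ln (cmod (z - w)) \<le> ln (2 / (1 + r)) + ln (cmod (1 - of_real r * (z * cnj w)))"
proof -
  have u: "cmod (z * cnj w) \<le> 1"
    using assms by (simp add: norm_mult mult_le_one)
  have "cmod (of_real r * (z * cnj w)) < 1"
  proof -
    have "cmod (of_real r * (z * cnj w)) \<le> r * 1"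
      using u assms unfolding norm_mult by (intro mult_mono) (auto simp: norm_mult)
    then show ?thesis using assms by simp
  qed
  then have pos: "cmod (1 - of_real r * (z * cnj w)) > 0"
    by auto
  have "(1 + r) * cmod (z - w) \<le> (1 + r) * cmod (1 - z * cnj w)"
    using norm_diff_le_norm_one_minus_cnj[OF assms(1,2)] assms by simp
  also have "\<dots> \<le> 2 * cmod (1 - of_real r * (z * cnj w))"
    using norm_one_minus_le_scaled[OF u, of r] assms by simp
  finally have "cmod (z - w) \<le> 2 / (1 + r) * cmod (1 - of_real r * (z * cnj w))"
    using assms by (simp add: field_simps)
  then have "ln (cmod (z - w)) \<le> ln (2 / (1 + r) * cmod (1 - of_real r * (z * cnj w)))"
    using assms by (intro ln_mono) simp_all
  also have "\<dots> = ln (2 / (1 + r)) + ln (cmod (1 - of_real r * (z * cnj w)))"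
    using pos assms by (intro ln_mult_pos) auto
  finally show ?thesis .
qed

text \<open>This is the real part of the Taylor series of \<open>- ln (1 - u)\<close>. The term at
  \<open>m = 0\<close> is zero because division by zero yields zero.\<close>

lemma ln_norm_one_minus_sums:
  fixes u :: complex
  assumes "cmod u < 1"
  shows "(\<lambda>m. Re (u ^ m) / real m) sums (- ln (cmod (1 - u)))"
proof -
  have "(\<lambda>m. - (u ^ m) / of_nat m) sums ln (1 - u)"
    using Ln_series'[of "- u"] assms by simp
  then have "(\<lambda>m. Re (- (u ^ m) / of_nat m)) sums Re (ln (1 - u))"
    by (rule sums_Re)
  moreover have "1 - u \<noteq> 0" using assms by auto
  ultimately have "(\<lambda>m. - (Re (u ^ m) / real m)) sums ln (cmod (1 - u))"
    by (simp add: Re_divide_of_nat)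
  from sums_minus[OF this] show ?thesis by simp
qed

text \<open>Comparing \<open>\<bar>z - w\<bar>\<close> with \<open>\<bar>1 - r z w\<^sup>*\<bar>\<close> regularises the logarithmic energy, and
  expanding the logarithm turns the regularised energy into a positive combination of squared
  power sums.\<close>

lemma power_sum_energy_bound:
  fixes Z :: "complex set"
  assumes fin: "finite Z" and disc: "\<And>z. z \<in> Z \<Longrightarrow> cmod z \<le> 1" and r: "0 < r" "r < 1" and m: "m > 0"
  defines "n \<equiv> real (card Z)"
  shows "r ^ m / real m * (cmod (\<Sum>z\<in>Z. z ^ m))\<^sup>2
    \<le> n\<^sup>2 * ln (2 / (1 + r)) - n * ln (1 - r) - (\<Sum>z\<in>Z. \<Sum>w\<in>Z - {z}. ln (cmod (z - w)))"
proof -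
  define L where "L z w = ln (cmod (1 - of_real r * (z * cnj w)))" for z w
  have small: "cmod (of_real r * (z * cnj w)) < 1" if "z \<in> Z" "w \<in> Z" for z w
  proof -
    have "cmod (z * cnj w) \<le> 1"
      using disc that by (simp add: norm_mult mult_le_one)
    then have "cmod (of_real r * (z * cnj w)) \<le> r * 1"
      using r unfolding norm_mult by (intro mult_mono) (auto simp: norm_mult)
    then show ?thesis using r by simp
  qed
  \<comment> \<open>The pairs on the diagonal are included, which is what turns each term into a
    full square.\<close>
  have "(\<lambda>k. \<Sum>z\<in>Z. \<Sum>w\<in>Z. Re ((of_real r * (z * cnj w)) ^ k) / real k) sums (\<Sum>z\<in>Z. \<Sum>w\<in>Z. - L z w)"
    unfolding L_def by (intro sums_sum ln_norm_one_minus_sums small)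
  also have "(\<lambda>k. \<Sum>z\<in>Z. \<Sum>w\<in>Z. Re ((of_real r * (z * cnj w)) ^ k) / real k)
      = (\<lambda>k. r ^ k / real k * (cmod (\<Sum>z\<in>Z. z ^ k))\<^sup>2)"
  proof
    fix k
    have "complex_of_real ((cmod (\<Sum>z\<in>Z. z ^ k))\<^sup>2) = (\<Sum>z\<in>Z. z ^ k) * cnj (\<Sum>w\<in>Z. w ^ k)"
      by (rule complex_norm_square)
    also have "\<dots> = (\<Sum>z\<in>Z. \<Sum>w\<in>Z. (z * cnj w) ^ k)"
      by (simp add: sum_product power_mult_distrib cnj_sum)
    finally have "Re (complex_of_real ((cmod (\<Sum>z\<in>Z. z ^ k))\<^sup>2)) = Re (\<Sum>z\<in>Z. \<Sum>w\<in>Z. (z * cnj w) ^ k)"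
      by simp
    then have "(cmod (\<Sum>z\<in>Z. z ^ k))\<^sup>2 = (\<Sum>z\<in>Z. \<Sum>w\<in>Z. Re ((z * cnj w) ^ k))"
      by (simp only: Re_complex_of_real Re_sum)
    moreover have "Re ((of_real r * (z * cnj w)) ^ k) = r ^ k * Re ((z * cnj w) ^ k)" for z w
      by (simp add: power_mult_distrib[of "complex_of_real r"] flip: of_real_power)
    ultimately show "(\<Sum>z\<in>Z. \<Sum>w\<in>Z. Re ((of_real r * (z * cnj w)) ^ k) / real k)
        = r ^ k / real k * (cmod (\<Sum>z\<in>Z. z ^ k))\<^sup>2"
      by (simp add: sum_distrib_left)
  qed
  finally have sums: "(\<lambda>k. r ^ k / real k * (cmod (\<Sum>z\<in>Z. z ^ k))\<^sup>2) sums (\<Sum>z\<in>Z. \<Sum>w\<in>Z. - L z w)" .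
  \<comment> \<open>All terms of the series are nonnegative, so a single one is at most the
    total.\<close>
  have "r ^ m / real m * (cmod (\<Sum>z\<in>Z. z ^ m))\<^sup>2 \<le> (\<Sum>z\<in>Z. \<Sum>w\<in>Z. - L z w)"
    using sum_le_suminf[OF sums_summable[OF sums], of "{m}"] r sums_unique[OF sums]
    by (auto simp del: sum_negf)
  also have "\<dots> = (\<Sum>z\<in>Z. - L z z) + (\<Sum>z\<in>Z. \<Sum>w\<in>Z - {z}. - L z w)"
    unfolding sum.distrib[symmetric] using fin by (intro sum.cong refl sum.remove)
  \<comment> \<open>On the diagonal the argument of the logarithm is at least \<open>1 - r\<close>;
    off it \<open>ln_norm_diff_le\<close> applies.\<close>
  also have "\<dots> \<le> (\<Sum>z\<in>Z. - ln (1 - r)) + (\<Sum>z\<in>Z. \<Sum>w\<in>Z - {z}. ln (2 / (1 + r)) - ln (cmod (z - w)))"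
  proof (intro add_mono sum_mono)
    fix z assume z: "z \<in> Z"
    have "1 - r \<le> 1 - cmod (of_real r * (z * cnj z))"
      using disc[OF z] r by (simp add: norm_mult mult_le_one mult_left_le)
    also have "\<dots> \<le> cmod (1 - of_real r * (z * cnj z))"
      using norm_triangle_ineq2[of 1 "of_real r * (z * cnj z)"] by simp
    finally have "ln (1 - r) \<le> L z z"
      using r unfolding L_def by (subst ln_le_cancel_iff) auto
    then show "- L z z \<le> - ln (1 - r)" by simp
  next
    fix z w assume zw: "z \<in> Z" "w \<in> Z - {z}"
    then show "- L z w \<le> ln (2 / (1 + r)) - ln (cmod (z - w))"
      using ln_norm_diff_le[of z w r] disc r unfolding L_def by auto
  qed
  also have "\<dots> = n * (n - 1) * ln (2 / (1 + r)) - n * ln (1 - r)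
      - (\<Sum>z\<in>Z. \<Sum>w\<in>Z - {z}. ln (cmod (z - w)))"
  proof -
    have "card Z > 0" if "z \<in> Z" for z
      using that fin card_gt_0_iff by blast
    then have "(\<Sum>z\<in>Z. real (card Z - 1) * ln (2 / (1 + r))) = (\<Sum>z\<in>Z. (n - 1) * ln (2 / (1 + r)))"
      unfolding n_def by (intro sum.cong refl) (simp add: of_nat_diff Suc_leI)
    then show ?thesis
      using fin by (simp add: sum_subtractf n_def)
  qed
  \<comment> \<open>As \<open>r < 1\<close>, the logarithm is nonnegative, so the number of ordered
    pairs may be enlarged to \<open>n^2\<close>.\<close>
  also have "n * (n - 1) * ln (2 / (1 + r)) \<le> n\<^sup>2 * ln (2 / (1 + r))"
    using r by (intro mult_right_mono) (auto simp: n_def power2_eq_square mult_left_mono)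
  finally show ?thesis by simp
qed

text \<open>Division by \<open>R\<close> brings the points into the unit disc and lowers the
  logarithmic energy by at most \<open>n^2 * ln R\<close>. The energy bound for the scaled points is
  then divided by \<open>n^2\<close>.\<close>

lemma power_sum_mean_bound:
  fixes Z :: "complex set"
  assumes fin: "finite Z" and ne: "Z \<noteq> {}" and disc: "\<And>z. z \<in> Z \<Longrightarrow> cmod z \<le> R" and R: "R \<ge> 1" and m: "m > 0"
    and energy: "(\<Sum>z\<in>Z. \<Sum>w\<in>Z - {z}. ln (cmod (z - w))) \<ge> 0"
  defines "n \<equiv> real (card Z)"
  shows "(cmod ((\<Sum>z\<in>Z. (z / of_real R) ^ m) / of_nat (card Z)))\<^sup>2
    \<le> real m * ((n + 1) / n) ^ m * (ln ((2 * n + 2) / (2 * n + 1)) + ln (n + 1) / n + ln R)"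
proof -
  have n: "n \<ge> 1"
    using fin ne by (simp add: n_def Suc_leI card_gt_0_iff)
  \<comment> \<open>With \<open>1 - r\<close> of order \<open>1 / n\<close>, the diagonal costs
    \<open>n * ln (n + 1)\<close> and the other pairs cost a multiple of \<open>n\<close>, both
    negligible against \<open>n^2\<close>, while \<open>r ^ m\<close> stays bounded away from 0 for
    fixed \<open>m\<close>.\<close>
  define r where "r = n / (n + 1)"
  have r: "0 < r" "r < 1" "2 / (1 + r) = (2 * n + 2) / (2 * n + 1)" "1 - r = inverse (n + 1)"
    using n by (auto simp: r_def field_simps)
  define f where "f z = z / complex_of_real R" for z
  have inj: "inj_on f A" for A
    using R by (auto simp: inj_on_def f_def)
  have cardf: "card (f ` Z) = card Z"
    using inj by (rule card_image)
  have en: "(\<Sum>z\<in>f ` Z. \<Sum>w\<in>f ` Z - {z}. ln (cmod (z - w))) \<ge> - (n\<^sup>2 * ln R)"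
  proof -
    have img: "f ` Z - {f z} = f ` (Z - {z})" if "z \<in> Z" for z
      using inj[of Z] that by (auto simp: inj_on_def)
    have "(\<Sum>z\<in>f ` Z. \<Sum>w\<in>f ` Z - {z}. ln (cmod (z - w)))
        = (\<Sum>z\<in>Z. \<Sum>w\<in>Z - {z}. ln (cmod (f z - f w)))"
      by (simp add: sum.reindex[OF inj] img)
    also have "\<dots> = (\<Sum>z\<in>Z. \<Sum>w\<in>Z - {z}. ln (cmod (z - w)) - ln R)"
      using R by (intro sum.cong refl)
        (auto simp: f_def ln_div norm_divide simp flip: diff_divide_distrib)
    also have "\<dots> = (\<Sum>z\<in>Z. \<Sum>w\<in>Z - {z}. ln (cmod (z - w))) - (\<Sum>z\<in>Z. real (card (Z - {z})) * ln R)"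
      by (simp add: sum_subtractf)
    also have "\<dots> \<ge> 0 - (\<Sum>z\<in>Z. n * ln R)"
      using R fin by (intro diff_mono energy sum_mono mult_right_mono) (auto simp: n_def intro!: card_mono)
    finally show ?thesis
      by (simp add: n_def power2_eq_square)
  qed
  have "r ^ m / real m * (cmod (\<Sum>z\<in>f ` Z. z ^ m))\<^sup>2
    \<le> n\<^sup>2 * ln (2 / (1 + r)) - n * ln (1 - r) - (\<Sum>z\<in>f ` Z. \<Sum>w\<in>f ` Z - {z}. ln (cmod (z - w)))"
    unfolding n_def cardf[symmetric]
  proof (rule power_sum_energy_bound)
    show "cmod w \<le> 1" if "w \<in> f ` Z" for w
      using that disc R by (auto simp: f_def norm_divide)
  qed (use fin r m in auto)
  also have "\<dots> \<le> n\<^sup>2 * ln (2 / (1 + r)) - n * ln (1 - r) + n\<^sup>2 * ln R"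
    using en by linarith
  also have "\<dots> = n\<^sup>2 * (ln ((2 * n + 2) / (2 * n + 1)) + ln (n + 1) / n + ln R)"
    using n unfolding r(3,4) ln_inverse distrib_left by (simp add: power2_eq_square)
  finally have main: "r ^ m / real m * (cmod (\<Sum>z\<in>f ` Z. z ^ m))\<^sup>2
    \<le> n\<^sup>2 * (ln ((2 * n + 2) / (2 * n + 1)) + ln (n + 1) / n + ln R)" (is "_ \<le> _ * ?E") .
  have "(cmod ((\<Sum>z\<in>Z. (z / of_real R) ^ m) / of_nat (card Z)))\<^sup>2 = (cmod (\<Sum>z\<in>f ` Z. z ^ m))\<^sup>2 / n\<^sup>2"
    unfolding sum.reindex[OF inj] comp_def by (simp add: f_def norm_divide power_divide n_def)
  also have "\<dots> = real m / r ^ m * (r ^ m / real m * (cmod (\<Sum>z\<in>f ` Z. z ^ m))\<^sup>2) / n\<^sup>2"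
    using r m by simp
  also have "\<dots> \<le> real m / r ^ m * (n\<^sup>2 * ?E) / n\<^sup>2"
    using main r by (intro divide_right_mono mult_left_mono) auto
  also have "\<dots> = real m / r ^ m * ?E"
    using n by simp
  also have "real m / r ^ m = real m * ((n + 1) / n) ^ m"
    using n by (simp add: r_def power_divide)
  finally show ?thesis .
qed

text \<open>The three summands are the costs of regularising, of the diagonal and of scaling; each
  vanishes in the limit.\<close>

lemma power_sum_mean_bound_tendsto_0:
  assumes "filterlim N at_top F" and "(R \<longlongrightarrow> 1) F"
  shows "((\<lambda>q. real m * ((real (N q) + 1) / real (N q)) ^ m
    * (ln ((2 * real (N q) + 2) / (2 * real (N q) + 1)) + ln (real (N q) + 1) / real (N q) + ln (R q))) \<longlongrightarrow> 0) F"
proof -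
  have lims: "(\<lambda>n. (real n + 1) / real n) \<longlonglongrightarrow> 1"
    "(\<lambda>n. ln ((2 * real n + 2) / (2 * real n + 1))) \<longlonglongrightarrow> 0"
    "(\<lambda>n. ln (real n + 1) / real n) \<longlonglongrightarrow> 0"
    by real_asymp+
  have "((\<lambda>q. real m * ((real (N q) + 1) / real (N q)) ^ m
    * (ln ((2 * real (N q) + 2) / (2 * real (N q) + 1)) + ln (real (N q) + 1) / real (N q) + ln (R q)))
      \<longlongrightarrow> real m * 1 ^ m * (0 + 0 + ln 1)) F"
    by (intro tendsto_intros assms(2) filterlim_compose[OF lims(1) assms(1)]
          filterlim_compose[OF lims(2) assms(1)] filterlim_compose[OF lims(3) assms(1)]) auto
  then show ?thesis by simp
qed

section \<open>Equidistribution near the unit circle\<close>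

lemma prob_space_circle_haar: "prob_space circle_haar"
  unfolding circle_haar_def
proof (rule prob_space.prob_space_distr)
  show "prob_space (uniform_measure lborel {0..<1::real})"
    by (rule prob_space_uniform_measure) auto
  show "(\<lambda>t. cis (2 * pi * t)) \<in> uniform_measure lborel {0..<1} \<rightarrow>\<^sub>M punctured_plane"
    using cis_measurable_punctured by (simp cong: measurable_cong_sets)
qed

lemma sets_circle_haar [measurable_cong]: "sets circle_haar = sets punctured_plane"
  by (simp add: circle_haar_def)

lemma borel_measurable_punctured_plane:
  fixes f :: "complex \<Rightarrow> complex"
  assumes "continuous_on (- {0}) f"
  shows "f \<in> borel_measurable punctured_plane"
  using assms by (rule borel_measurable_continuous_on_restrict)

lemma borel_measurable_circle_haar:
  fixes f :: "complex \<Rightarrow> complex"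
  assumes "continuous_on (- {0}) f"
  shows "f \<in> borel_measurable circle_haar"
  using borel_measurable_punctured_plane[OF assms] by (simp cong: measurable_cong_sets add: sets_circle_haar)

lemma AE_circle_haar_norm: "AE z in circle_haar. cmod z = 1"
proof -
  interpret prob_space circle_haar by (rule prob_space_circle_haar)
  have "sphere (0::complex) 1 \<in> events"
    unfolding sets_circle_haar by (subst sets_restrict_space_iff) auto
  moreover have "prob (sphere 0 1) = 1"
    using circle_haar_concentrated by (simp add: measure_def)
  ultimately have "AE z in circle_haar. z \<in> sphere 0 1"
    using prob_eq_1 by blast
  then show ?thesis by simp
qed

text \<open>The integrand may be unbounded near 0 or infinity, as powers of z are, but it is bounded
  on the compact circle, where the measure is concentrated.\<close>

lemma integrable_circle_haar_continuous:
  fixes h :: "complex \<Rightarrow> complex"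
  assumes h: "continuous_on (- {0}) h"
  shows "integrable circle_haar h"
proof -
  interpret prob_space circle_haar by (rule prob_space_circle_haar)
  have "compact (h ` sphere 0 1)"
    by (intro compact_continuous_image continuous_on_subset[OF h]) auto
  then obtain B where B: "\<And>z. z \<in> sphere 0 1 \<Longrightarrow> cmod (h z) \<le> B"
    by (meson compact_imp_bounded bounded_iff imageI)
  then have "AE z in circle_haar. cmod (h z) \<le> B"
    using AE_circle_haar_norm by (auto elim!: eventually_mono)
  then show ?thesis
    using borel_measurable_circle_haar[OF h] by (rule integrable_const_bound)
qed

lemma norm_circle_haar_integral_diff_le:
  fixes f g :: "complex \<Rightarrow> complex"
  assumes f: "continuous_on (- {0}) f" and g: "continuous_on (- {0}) g"
    and le: "\<And>z. cmod z = 1 \<Longrightarrow> cmod (f z - g z) \<le> e"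
  shows "cmod ((\<integral>z. f z \<partial>circle_haar) - (\<integral>z. g z \<partial>circle_haar)) \<le> e"
proof -
  interpret prob_space circle_haar by (rule prob_space_circle_haar)
  note int = integrable_circle_haar_continuous
  have "(\<integral>z. f z \<partial>circle_haar) - (\<integral>z. g z \<partial>circle_haar) = (\<integral>z. f z - g z \<partial>circle_haar)"
    using int[OF f] int[OF g] by simp
  also have "cmod \<dots> \<le> (\<integral>z. cmod (f z - g z) \<partial>circle_haar)"
    by (rule integral_norm_bound)
  also have "\<dots> \<le> (\<integral>z. e \<partial>circle_haar)"
    using AE_circle_haar_norm int[OF f] int[OF g] le
    by (intro integral_mono_AE) (auto elim!: eventually_mono)
  also have "\<dots> = e"
    by (simp add: prob_space)
  finally show ?thesis .
qed

text \<open>Rotation by a number \<open>u\<close> with \<open>u powi m = -1\<close> preserves the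
  measure and changes the sign of the integrand.\<close>

lemma circle_haar_integral_power_int:
  assumes "m \<noteq> 0"
  shows "(\<integral>z. z powi m \<partial>circle_haar) = 0"
proof -
  define u where "u = cis (pi / real_of_int m)"
  have u: "cmod u = 1" "u powi m = -1"
    using assms by (simp_all add: u_def cis_power_int)
  have h: "(\<lambda>z. z powi m) \<in> borel_measurable punctured_plane"
    by (intro borel_measurable_punctured_plane continuous_intros) auto
  have "((*) u) \<in> measurable punctured_plane punctured_plane"
    using u by (intro measurable_restrict_space2 measurable_restrict_space1)
      (auto simp: space_restrict_space)
  then have mu: "((*) u) \<in> measurable circle_haar punctured_plane"
    by (simp cong: measurable_cong_sets add: sets_circle_haar)
  have "(\<integral>z. z powi m \<partial>circle_haar) = (\<integral>z. z powi m \<partial>distr circle_haar punctured_plane ((*) u))"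
    by (simp add: circle_haar_rotation[OF u(1)])
  also have "\<dots> = (\<integral>z. (u * z) powi m \<partial>circle_haar)"
    by (rule integral_distr[OF mu h])
  also have "\<dots> = - (\<integral>z. z powi m \<partial>circle_haar)"
    by (simp add: power_int_mult_distrib u(2))
  finally show ?thesis by simp
qed

section \<open>Approximation by trigonometric polynomials\<close>

text \<open>These are Laurent polynomials as functions. Generating them by monomials and sums alone
  leaves only two cases in arguments by linearity.\<close>

inductive trig_poly :: "(complex \<Rightarrow> complex) \<Rightarrow> bool" where
  monom: "trig_poly (\<lambda>z. c * z powi m)"
| add: "trig_poly f \<Longrightarrow> trig_poly g \<Longrightarrow> trig_poly (\<lambda>z. f z + g z)"

lemma continuous_on_trig_poly: "trig_poly h \<Longrightarrow> continuous_on (- {0}) h"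
  by (induction rule: trig_poly.induct) (auto intro!: continuous_intros)

text \<open>Exponents add only away from 0: at 0 the powers with exponents 1 and -1 are both 0,
  while the power with exponent 0 is 1.\<close>

lemma trig_poly_mult_monom:
  "trig_poly g \<Longrightarrow> \<exists>h. trig_poly h \<and> (\<forall>z. z \<noteq> 0 \<longrightarrow> c * z powi m * g z = h z)"
proof (induction rule: trig_poly.induct)
  case (monom d k)
  have "c * z powi m * (d * z powi k) = c * d * z powi (m + k)" if "z \<noteq> 0" for z
    using that by (simp add: power_int_add)
  then show ?case
    using trig_poly.monom[of "c * d" "m + k"] by blast
next
  case (add g1 g2)
  then obtain h1 h2 where "trig_poly h1" "\<forall>z. z \<noteq> 0 \<longrightarrow> c * z powi m * g1 z = h1 z"
    "trig_poly h2" "\<forall>z. z \<noteq> 0 \<longrightarrow> c * z powi m * g2 z = h2 z"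
    by blast
  then show ?case
    by (intro exI[of _ "\<lambda>z. h1 z + h2 z"]) (simp add: trig_poly.add distrib_left)
qed

lemma trig_poly_mult:
  "trig_poly f \<Longrightarrow> trig_poly g \<Longrightarrow> \<exists>h. trig_poly h \<and> (\<forall>z. z \<noteq> 0 \<longrightarrow> f z * g z = h z)"
proof (induction rule: trig_poly.induct)
  case (monom c m)
  then show ?case by (rule trig_poly_mult_monom)
next
  case (add f1 f2)
  then obtain h1 h2 where "trig_poly h1" "\<forall>z. z \<noteq> 0 \<longrightarrow> f1 z * g z = h1 z"
    "trig_poly h2" "\<forall>z. z \<noteq> 0 \<longrightarrow> f2 z * g z = h2 z"
    by blast
  then show ?case
    by (intro exI[of _ "\<lambda>z. h1 z + h2 z"]) (simp add: trig_poly.add distrib_right)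
qed

text \<open>On the circle the complex conjugate is the inverse, so real and imaginary parts, and
  with them all real-linear functionals, are Laurent polynomials; sums and products preserve
  this.\<close>

lemma real_polynomial_function_trig_poly:
  fixes g :: "complex \<Rightarrow> real"
  assumes "real_polynomial_function g"
  shows "\<exists>h. trig_poly h \<and> (\<forall>z. cmod z = 1 \<longrightarrow> complex_of_real (g z) = h z)"
  using assms
proof (induction rule: real_polynomial_function.induct)
  case (linear f)
  interpret bounded_linear f by fact
  \<comment> \<open>The coefficients come from \<open>Re z = (z + 1/z) / 2\<close> and
    \<open>Im z = (z - 1/z) / (2 * \<i>)\<close> on the circle.\<close>
  define a where "a = complex_of_real (f 1) / 2"
  define b where "b = complex_of_real (f \<i>) / (2 * \<i>)"
  have "complex_of_real (f z) = (a + b) * z powi 1 + (a - b) * z powi (-1)" if z: "cmod z = 1" for z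
  proof -
    have "f z = f (Re z *\<^sub>R 1 + Im z *\<^sub>R \<i>)"
      by (rule arg_cong[of _ _ f]) (simp add: complex_eq_iff)
    also have "\<dots> = Re z * f 1 + Im z * f \<i>"
      by (simp only: add scaleR real_scaleR_def)
    finally have fz: "f z = Re z * f 1 + Im z * f \<i>" .
    have inv: "z powi (-1) = cnj z"
      using z by (simp add: power_int_minus inverse_complex_def complex_eq_iff cmod_def)
    show ?thesis
      unfolding inv fz a_def b_def by (simp add: complex_eq_iff)
  qed
  then show ?case
    using trig_poly.add[OF trig_poly.monom[of "a + b" 1] trig_poly.monom[of "a - b" "-1"]] by blast
next
  case (const c)
  then show ?case
    using trig_poly.monom[of "complex_of_real c" 0] by auto
next
  case (add f g)
  then obtain h k where "trig_poly h" "\<forall>z. cmod z = 1 \<longrightarrow> complex_of_real (f z) = h z"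
    "trig_poly k" "\<forall>z. cmod z = 1 \<longrightarrow> complex_of_real (g z) = k z"
    by blast
  then show ?case
    by (intro exI[of _ "\<lambda>z. h z + k z"]) (auto intro: trig_poly.add)
next
  case (mult f g)
  then obtain h k where hk: "trig_poly h" "\<forall>z. cmod z = 1 \<longrightarrow> complex_of_real (f z) = h z"
    "trig_poly k" "\<forall>z. cmod z = 1 \<longrightarrow> complex_of_real (g z) = k z"
    by blast
  obtain l where l: "trig_poly l" "\<forall>z. z \<noteq> 0 \<longrightarrow> h z * k z = l z"
    using trig_poly_mult[OF hk(1,3)] by blast
  have "complex_of_real (f z * g z) = l z" if "cmod z = 1" for z
    using l(2) hk(2,4) that by (metis norm_zero of_real_mult zero_neq_one)
  then show ?case using l(1) by blast
qed

text \<open>Stone-Weierstrass yields a polynomial in the real and imaginary parts; its two real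
  components are converted separately.\<close>

lemma trig_poly_approx:
  fixes f :: "complex \<Rightarrow> complex"
  assumes "continuous_on (sphere 0 1) f" "e > 0"
  obtains h where "trig_poly h" "\<And>z. cmod z = 1 \<Longrightarrow> cmod (f z - h z) < e"
proof -
  obtain g where g: "polynomial_function g" "\<And>z. z \<in> sphere 0 1 \<Longrightarrow> cmod (f z - g z) < e"
    using Stone_Weierstrass_polynomial_function[OF compact_sphere assms] by blast
  have poly: "real_polynomial_function (Re \<circ> g)" "real_polynomial_function (Im \<circ> g)"
    using g(1) bounded_linear_Re bounded_linear_Im unfolding polynomial_function_def by blast+
  obtain h where h: "trig_poly h" "\<And>z. cmod z = 1 \<Longrightarrow> complex_of_real ((Re \<circ> g) z) = h z"
    using real_polynomial_function_trig_poly[OF poly(1)] by blast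
  obtain k where k: "trig_poly k" "\<And>z. cmod z = 1 \<Longrightarrow> complex_of_real ((Im \<circ> g) z) = k z"
    using real_polynomial_function_trig_poly[OF poly(2)] by blast
  \<comment> \<open>Multiplication by the monomial of exponent 0 serves as multiplication by the
    scalar \<i>.\<close>
  obtain l where l: "trig_poly l" "\<And>z. z \<noteq> 0 \<Longrightarrow> \<i> * z powi 0 * k z = l z"
    using trig_poly_mult_monom[OF k(1), of \<i> 0] by blast
  have "g z = h z + l z" if "cmod z = 1" for z
  proof -
    have "z \<noteq> 0" using that by auto
    then have lz: "l z = \<i> * k z" using l(2)[of z] by simp
    show ?thesis
      unfolding lz h(2)[OF that, symmetric] k(2)[OF that, symmetric] by (simp add: complex_eq_iff)
  qed
  then show thesis
    using that[OF trig_poly.add[OF h(1) l(1)]] g(2) by auto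
qed

section \<open>Equidistribution of abstract point sets\<close>

text \<open>Models the sets of conjugates: \<open>R\<close> stands for the house,
  \<open>ln_norm\<close> records that the norm is a nonzero integer, and \<open>energy\<close>
  records the same for the discriminant.\<close>

locale near_circle_sets =
  fixes Z :: "nat \<Rightarrow> complex set" and R :: "nat \<Rightarrow> real"
  assumes fin: "finite (Z q)" and ne: "Z q \<noteq> {}"
    and nonzero: "z \<in> Z q \<Longrightarrow> z \<noteq> 0" and norm_le: "z \<in> Z q \<Longrightarrow> cmod z \<le> R q" and R_ge: "R q \<ge> 1"
    and ln_norm: "(\<Sum>z\<in>Z q. ln (cmod z)) \<ge> 0"
    and energy: "(\<Sum>z\<in>Z q. \<Sum>w\<in>Z q - {z}. ln (cmod (z - w))) \<ge> 0"
    and card_lim: "filterlim (\<lambda>q. card (Z q)) at_top sequentially"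
    and R_lim: "R \<longlonglongrightarrow> 1"
begin

definition mean :: "nat \<Rightarrow> (complex \<Rightarrow> complex) \<Rightarrow> complex" where
  "mean q f = (\<Sum>z\<in>Z q. f z) / of_nat (card (Z q))"

lemma card_pos: "card (Z q) > 0"
  using fin ne by (simp add: card_gt_0_iff)

lemma mean_diff: "mean q f - mean q g = mean q (\<lambda>z. f z - g z)"
  by (simp add: mean_def sum_subtractf diff_divide_distrib)

lemma ln_R_tendsto: "(\<lambda>q. ln (R q)) \<longlonglongrightarrow> 0"
  using tendsto_ln[OF R_lim] by simp

text \<open>By \<open>ln_norm\<close> the mean of \<open>ln (R q / cmod z)\<close> is at most
  \<open>ln (R q)\<close>. A pointwise bound with this logarithmic penalty for points deep inside
  the disc thus costs only \<open>b * ln (R q)\<close> on average.\<close>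

lemma norm_mean_le:
  assumes le: "\<And>z. z \<in> Z q \<Longrightarrow> cmod (f z) \<le> a + b * ln (R q / cmod z)" and b: "b \<ge> 0"
  shows "cmod (mean q f) \<le> a + b * ln (R q)"
proof -
  let ?n = "real (card (Z q))"
  have "cmod (\<Sum>z\<in>Z q. f z) \<le> (\<Sum>z\<in>Z q. a + b * ln (R q / cmod z))"
    using le by (rule sum_norm_le)
  also have "\<dots> = (\<Sum>z\<in>Z q. a + b * ln (R q) - b * ln (cmod z))"
    using nonzero R_ge[of q] by (intro sum.cong refl) (simp add: ln_div algebra_simps)
  also have "\<dots> = ?n * (a + b * ln (R q)) - b * (\<Sum>z\<in>Z q. ln (cmod z))"
    by (simp add: sum_subtractf sum_distrib_left)
  also have "\<dots> \<le> ?n * (a + b * ln (R q))"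
    using ln_norm b by simp
  finally show ?thesis
    using card_pos[of q] by (simp add: mean_def norm_divide field_simps)
qed

lemma mean_scaled_power_tendsto:
  assumes m: "m > 0"
  shows "(\<lambda>q. mean q (\<lambda>z. (z / of_real (R q)) ^ m)) \<longlonglongrightarrow> 0"
proof -
  let ?S = "\<lambda>q. mean q (\<lambda>z. (z / of_real (R q)) ^ m)"
  have "(\<lambda>q. (cmod (?S q))\<^sup>2) \<longlonglongrightarrow> 0"
  proof (rule tendsto_sandwich[OF _ _ tendsto_const power_sum_mean_bound_tendsto_0[OF card_lim R_lim]])
    show "\<forall>\<^sub>F q in sequentially. (cmod (?S q))\<^sup>2
      \<le> real m * ((real (card (Z q)) + 1) / real (card (Z q))) ^ m
        * (ln ((2 * real (card (Z q)) + 2) / (2 * real (card (Z q)) + 1))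
           + ln (real (card (Z q)) + 1) / real (card (Z q)) + ln (R q))"
      unfolding mean_def
      using power_sum_mean_bound[OF fin ne norm_le R_ge m energy] by (intro always_eventually allI)
  qed auto
  then have "(\<lambda>q. sqrt ((cmod (?S q))\<^sup>2)) \<longlonglongrightarrow> sqrt 0"
    by (rule tendsto_real_sqrt)
  then show ?thesis
    by (simp add: tendsto_norm_zero_iff)
qed

text \<open>Replacing \<open>z / R\<close> by its projection \<open>sgn z\<close> changes the power
  by \<open>1 - t ^ m\<close> with \<open>t = cmod z / R\<close>, which is at most
  \<open>- m * ln t\<close>, a penalty of the form that \<open>norm_mean_le\<close> absorbs.\<close>

lemma mean_sgn_power_tendsto:
  assumes m: "m > 0"
  shows "(\<lambda>q. mean q (\<lambda>z. sgn z ^ m)) \<longlonglongrightarrow> 0"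
proof -
  have "cmod (mean q (\<lambda>z. sgn z ^ m - (z / of_real (R q)) ^ m)) \<le> 0 + real m * ln (R q)" for q
  proof (rule norm_mean_le)
    fix z assume z: "z \<in> Z q"
    define t where "t = cmod z / R q"
    have t: "0 < t" "t \<le> 1"
      using nonzero[OF z] norm_le[OF z] R_ge[of q] by (auto simp: t_def)
    have "z / of_real (R q) = sgn z * of_real t"
      using nonzero[OF z] by (simp add: t_def sgn_eq)
    then have "sgn z ^ m - (z / of_real (R q)) ^ m = sgn z ^ m * of_real (1 - t ^ m)"
      by (simp add: power_mult_distrib algebra_simps)
    then have "cmod (sgn z ^ m - (z / of_real (R q)) ^ m) = \<bar>1 - t ^ m\<bar>"
      using nonzero[OF z] by (simp only: norm_mult norm_power norm_sgn norm_of_real) simp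
    also have "\<dots> = 1 - t ^ m"
      using t by (simp add: power_le_one)
    also have "\<dots> \<le> real m * (1 - t)"
      using Bernoulli_inequality[of "t - 1" m] t by (simp add: algebra_simps)
    also have "1 - t \<le> - ln t"
      using ln_le_minus_one[OF t(1)] by simp
    also have "- ln t = ln (R q / cmod z)"
      using nonzero[OF z] R_ge[of q] by (simp add: t_def ln_div)
    finally show "cmod (sgn z ^ m - (z / of_real (R q)) ^ m) \<le> 0 + real m * ln (R q / cmod z)"
      by (simp add: mult_left_mono)
  qed simp
  then have "(\<lambda>q. mean q (\<lambda>z. sgn z ^ m - (z / of_real (R q)) ^ m)) \<longlonglongrightarrow> 0"
    by (intro Lim_null_comparison[OF _ tendsto_mult_right_zero[OF ln_R_tendsto, of "real m"]]) auto
  from tendsto_add[OF this mean_scaled_power_tendsto[OF m]] show ?thesis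
    by (simp add: mean_diff[symmetric])
qed

text \<open>Since \<open>sgn z\<close> lies on the circle, its negative powers are the complex
  conjugates of the positive ones.\<close>

lemma mean_sgn_power_int_tendsto:
  assumes m: "m \<noteq> 0"
  shows "(\<lambda>q. mean q (\<lambda>z. sgn z powi m)) \<longlonglongrightarrow> 0"
proof (cases "m > 0")
  case True
  then show ?thesis
    using mean_sgn_power_tendsto[of "nat m"] by (simp add: power_int_def)
next
  case False
  have "mean q (\<lambda>z. sgn z powi m) = cnj (mean q (\<lambda>z. sgn z ^ nat (- m)))" for q
  proof -
    have "sgn z powi m = cnj (sgn z ^ nat (- m))" if "z \<in> Z q" for z
    proof -
      have "inverse (sgn z) = cnj (sgn z)"
        using nonzero[OF that]
        by (simp add: sgn_eq field_simps) (simp add: complex_norm_square[symmetric] power2_eq_square flip: of_real_mult)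
      then show ?thesis using False by (simp add: power_int_def)
    qed
    then show ?thesis
      unfolding mean_def complex_cnj_divide cnj_sum complex_cnj_of_nat by simp
  qed
  moreover have "(\<lambda>q. cnj (mean q (\<lambda>z. sgn z ^ nat (- m)))) \<longlonglongrightarrow> cnj 0"
    using False m by (intro tendsto_cnj mean_sgn_power_tendsto) auto
  ultimately show ?thesis by simp
qed

text \<open>The constant monomial has the same mean and integral; for every other monomial both
  limit and integral are 0. Linearity does the rest.\<close>

lemma mean_sgn_trig_poly_tendsto:
  "trig_poly h \<Longrightarrow> (\<lambda>q. mean q (\<lambda>z. h (sgn z))) \<longlonglongrightarrow> (\<integral>z. h z \<partial>circle_haar)"
proof (induction rule: trig_poly.induct)
  case (monom c m)
  interpret prob_space circle_haar by (rule prob_space_circle_haar)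
  have eq: "mean q (\<lambda>z. c * sgn z powi m) = c * mean q (\<lambda>z. sgn z powi m)" for q
    by (simp add: mean_def sum_distrib_left)
  show ?case
  proof (cases "m = 0")
    case True
    then show ?thesis
      using card_pos by (simp add: mean_def prob_space)
  next
    case False
    then show ?thesis
      using tendsto_mult_right_zero[OF mean_sgn_power_int_tendsto[OF False], of c]
      by (simp add: eq circle_haar_integral_power_int)
  qed
next
  case (add f g)
  have "mean q (\<lambda>z. f (sgn z) + g (sgn z)) = mean q (\<lambda>z. f (sgn z)) + mean q (\<lambda>z. g (sgn z))" for q
    by (simp add: mean_def sum.distrib add_divide_distrib)
  moreover have "(\<integral>z. f z + g z \<partial>circle_haar) = (\<integral>z. f z \<partial>circle_haar) + (\<integral>z. g z \<partial>circle_haar)"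
    using add.hyps by (intro Bochner_Integration.integral_add integrable_circle_haar_continuous continuous_on_trig_poly)
  ultimately show ?case
    using tendsto_add[OF add.IH] by simp
qed

lemma mean_sgn_tendsto:
  assumes f: "continuous_on (- {0}) f"
  shows "(\<lambda>q. mean q (\<lambda>z. f (sgn z))) \<longlonglongrightarrow> (\<integral>z. f z \<partial>circle_haar)"
proof (rule tendstoI)
  fix e :: real assume e: "e > 0"
  have "continuous_on (sphere 0 1) f"
    by (rule continuous_on_subset[OF f]) auto
  then obtain h where h: "trig_poly h" "\<And>z. cmod z = 1 \<Longrightarrow> cmod (f z - h z) < e / 3"
    using trig_poly_approx[of f "e / 3"] e by auto
  have "\<forall>\<^sub>F q in sequentially. dist (mean q (\<lambda>z. h (sgn z))) (\<integral>z. h z \<partial>circle_haar) < e / 3"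
    using tendstoD[OF mean_sgn_trig_poly_tendsto[OF h(1)], of "e / 3"] e by simp
  then show "\<forall>\<^sub>F q in sequentially. dist (mean q (\<lambda>z. f (sgn z))) (\<integral>z. f z \<partial>circle_haar) < e"
  proof eventually_elim
    case (elim q)
    \<comment> \<open>With \<open>b = 0\<close>, \<open>norm_mean_le\<close> says that a mean is
      bounded by a uniform bound of its terms.\<close>
    have "cmod (mean q (\<lambda>z. f (sgn z) - h (sgn z))) \<le> e / 3 + 0 * ln (R q)"
      using h(2) nonzero by (intro norm_mean_le) (auto simp: norm_sgn intro!: less_imp_le)
    then have 1: "dist (mean q (\<lambda>z. f (sgn z))) (mean q (\<lambda>z. h (sgn z))) \<le> e / 3"
      by (simp add: dist_norm mean_diff)
    have 2: "dist (\<integral>z. f z \<partial>circle_haar) (\<integral>z. h z \<partial>circle_haar) \<le> e / 3"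
      unfolding dist_norm using h(2)
      by (intro norm_circle_haar_integral_diff_le f continuous_on_trig_poly[OF h(1)]) (auto intro: less_imp_le)
    show ?case
      using 1 2 elim
        dist_triangle[of "mean q (\<lambda>z. f (sgn z))" "\<integral>z. f z \<partial>circle_haar" "mean q (\<lambda>z. h (sgn z))"]
        dist_triangle2[of "mean q (\<lambda>z. h (sgn z))" "\<integral>z. f z \<partial>circle_haar" "\<integral>z. h z \<partial>circle_haar"]
      by linarith
  qed
qed

text \<open>It remains to compare \<open>f z\<close> with \<open>f (sgn z)\<close>: uniform
  continuity handles the points near the circle, and boundedness together with the logarithmic
  penalty handles those well inside.\<close>

theorem mean_tendsto_circle_haar:
  assumes f: "continuous_on (- {0}) f" and bdd: "bounded (f ` (- {0}))"
  shows "(\<lambda>q. mean q f) \<longlonglongrightarrow> (\<integral>z. f z \<partial>circle_haar)"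
proof -
  obtain B where B: "B > 0" "\<And>z. z \<noteq> 0 \<Longrightarrow> cmod (f z) \<le> B"
    using bdd unfolding bounded_pos by auto
  have "(\<lambda>q. mean q (\<lambda>z. f z - f (sgn z))) \<longlonglongrightarrow> 0"
  proof (rule tendstoI)
    fix e :: real assume e: "e > 0"
    define A :: "complex set" where "A = cball 0 2 - ball 0 (1/2)"
    have "continuous_on A f"
      by (rule continuous_on_subset[OF f]) (auto simp: A_def)
    moreover have "compact A"
      unfolding A_def by (intro compact_diff) auto
    ultimately have "uniformly_continuous_on A f"
      by (rule compact_uniformly_continuous)
    then obtain d0 where d0: "d0 > 0" "\<And>z w. z \<in> A \<Longrightarrow> w \<in> A \<Longrightarrow> dist z w < d0 \<Longrightarrow> dist (f z) (f w) < e / 2"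
      using e unfolding uniformly_continuous_on_def by (metis half_gt_zero)
    \<comment> \<open>The cap at 1/2 keeps the points with \<open>1 - d < cmod z < 1 + d\<close>
      inside the annulus \<open>A\<close>, where uniform continuity is available.\<close>
    define d where "d = min d0 (1/2)"
    have d: "0 < d" "d \<le> d0" "d \<le> 1/2" using d0 by (auto simp: d_def)
    have "\<forall>\<^sub>F q in sequentially. R q < 1 + d"
      using order_tendstoD(2)[OF R_lim, of "1 + d"] d by simp
    moreover have "\<forall>\<^sub>F q in sequentially. 2 * B / d * ln (R q) < e / 2"
      using order_tendstoD(2)[OF tendsto_mult_right_zero[OF ln_R_tendsto, of "2 * B / d"], of "e / 2"] e
      by simp
    ultimately show "\<forall>\<^sub>F q in sequentially. dist (mean q (\<lambda>z. f z - f (sgn z))) 0 < e"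
    proof eventually_elim
      case (elim q)
      have "cmod (mean q (\<lambda>z. f z - f (sgn z))) \<le> e / 2 + 2 * B / d * ln (R q)"
      proof (rule norm_mean_le)
        show "2 * B / d \<ge> 0" using B d by simp
        fix z assume z: "z \<in> Z q"
        note z0 = nonzero[OF z]
        have Rz: "1 \<le> R q / cmod z"
          using norm_le[OF z] z0 by simp
        show "cmod (f z - f (sgn z)) \<le> e / 2 + 2 * B / d * ln (R q / cmod z)"
        proof (cases "cmod z > 1 - d")
          case True
          have "z - sgn z = sgn z * of_real (cmod z - 1)"
            using z0 by (simp add: sgn_eq field_simps)
          then have "cmod (z - sgn z) = \<bar>cmod z - 1\<bar>"
            using z0 by (simp only: norm_mult norm_sgn norm_of_real) simp
          then have "dist z (sgn z) < d0"
            using True norm_le[OF z] elim(1) d unfolding dist_norm by linarith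
          moreover have "z \<in> A" "sgn z \<in> A"
            using True norm_le[OF z] elim(1) d z0 by (auto simp: A_def norm_sgn)
          ultimately have "cmod (f z - f (sgn z)) < e / 2"
            using d0(2) by (simp add: dist_norm)
          moreover have "2 * B / d * ln (R q / cmod z) \<ge> 0"
            using B d Rz by simp
          ultimately show ?thesis by linarith
        next
          case False
          \<comment> \<open>For \<open>cmod z \<le> 1 - d\<close> the penalty is at least
            \<open>d\<close>, so the factor \<open>2 * B / d\<close> makes it exceed the trivial
            bound \<open>2 * B\<close>.\<close>
          have ln_ge: "d \<le> ln (R q / cmod z)"
          proof -
            have "ln (cmod z) \<le> cmod z - 1"
              using z0 by (intro ln_le_minus_one) simp
            moreover have "ln (R q) \<ge> 0"
              using R_ge[of q] by simp
            moreover have "ln (R q / cmod z) = ln (R q) - ln (cmod z)"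
              using z0 R_ge[of q] by (simp add: ln_div)
            ultimately show ?thesis
              using False by linarith
          qed
          have "cmod (f z - f (sgn z)) \<le> cmod (f z) + cmod (f (sgn z))"
            by (rule norm_triangle_ineq4)
          also have "\<dots> \<le> 2 * B"
            using B(2)[OF z0] B(2)[of "sgn z"] z0 by (simp add: sgn_zero_iff)
          also have "\<dots> = 2 * B / d * d"
            using d by simp
          also have "\<dots> \<le> 2 * B / d * ln (R q / cmod z)"
            using B d ln_ge by (intro mult_left_mono) auto
          finally show ?thesis
            using e by simp
        qed
      qed
      then show ?case using elim(2) by simp
    qed
  qed
  from tendsto_add[OF this mean_sgn_tendsto[OF f]] show ?thesis
    by (simp add: mean_diff[symmetric])
qed

end

section \<open>Embeddings and conjugates\<close>

lemma is_subfield_Q_adjoin: "is_subfield (Q_adjoin \<alpha>)"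
  unfolding is_subfield_def Q_adjoin_def by blast

lemma self_in_Q_adjoin: "\<alpha> \<in> Q_adjoin \<alpha>"
  unfolding Q_adjoin_def by blast

lemma Q_adjoin_subset: "is_subfield K \<Longrightarrow> \<alpha> \<in> K \<Longrightarrow> Q_adjoin \<alpha> \<subseteq> K"
  unfolding Q_adjoin_def by blast

lemma
  assumes "is_subfield K"
  shows is_subfield_0: "0 \<in> K" and is_subfield_1: "1 \<in> K"
    and is_subfield_add: "x \<in> K \<Longrightarrow> y \<in> K \<Longrightarrow> x + y \<in> K"
    and is_subfield_mult: "x \<in> K \<Longrightarrow> y \<in> K \<Longrightarrow> x * y \<in> K"
    and is_subfield_uminus: "x \<in> K \<Longrightarrow> - x \<in> K"
    and is_subfield_inverse: "x \<in> K \<Longrightarrow> inverse x \<in> K"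
  using assms unfolding is_subfield_def by blast+

lemma embedding_0:
  assumes "\<sigma> \<in> embeddings \<alpha>"
  shows "\<sigma> 0 = 0"
proof -
  have "\<sigma> (0 + 0) = \<sigma> 0 + \<sigma> 0"
    using assms is_subfield_0[OF is_subfield_Q_adjoin] unfolding embeddings_def by blast
  then show ?thesis by simp
qed

lemma embedding_uminus:
  assumes s: "\<sigma> \<in> embeddings \<alpha>" and x: "x \<in> Q_adjoin \<alpha>"
  shows "\<sigma> (- x) = - \<sigma> x"
proof -
  have "\<sigma> (x + - x) = \<sigma> x + \<sigma> (- x)"
    using s x is_subfield_uminus[OF is_subfield_Q_adjoin x] unfolding embeddings_def by blast
  then show ?thesis
    using embedding_0[OF s] by (simp add: eq_neg_iff_add_eq_0 add.commute)
qed

lemma embedding_inverse: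
  assumes s: "\<sigma> \<in> embeddings \<alpha>" and x: "x \<in> Q_adjoin \<alpha>"
  shows "\<sigma> (inverse x) = inverse (\<sigma> x)"
proof (cases "x = 0")
  case True
  then show ?thesis using embedding_0[OF s] by simp
next
  case False
  have "\<sigma> (x * inverse x) = \<sigma> x * \<sigma> (inverse x)"
    using s x is_subfield_inverse[OF is_subfield_Q_adjoin x] unfolding embeddings_def by blast
  moreover have "\<sigma> 1 = 1" using s unfolding embeddings_def by blast
  ultimately have "\<sigma> x * \<sigma> (inverse x) = 1" using False by simp
  then show ?thesis by (metis inverse_unique)
qed

text \<open>The points of agreement form a subfield containing \<alpha>, hence all of
  \<open>Q_adjoin \<alpha>\<close>; outside it extensionality decides.\<close>

lemma embeddings_eqI:
  assumes s: "\<sigma> \<in> embeddings \<alpha>" and t: "\<tau> \<in> embeddings \<alpha>" and eq: "\<sigma> \<alpha> = \<tau> \<alpha>"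
  shows "\<sigma> = \<tau>"
proof -
  let ?E = "{x \<in> Q_adjoin \<alpha>. \<sigma> x = \<tau> x}"
  note K = is_subfield_Q_adjoin[of \<alpha>]
  have hom: "\<rho> 1 = 1" "\<And>x y. x \<in> Q_adjoin \<alpha> \<Longrightarrow> y \<in> Q_adjoin \<alpha> \<Longrightarrow> \<rho> (x + y) = \<rho> x + \<rho> y \<and> \<rho> (x * y) = \<rho> x * \<rho> y"
    if "\<rho> \<in> embeddings \<alpha>" for \<rho>
    using that unfolding embeddings_def by blast+
  have "is_subfield ?E"
    unfolding is_subfield_def
    using is_subfield_0[OF K] is_subfield_1[OF K] is_subfield_add[OF K] is_subfield_mult[OF K]
      is_subfield_uminus[OF K] is_subfield_inverse[OF K] hom[OF s] hom[OF t] embedding_0[OF s] embedding_0[OF t]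
      embedding_uminus[OF s] embedding_uminus[OF t] embedding_inverse[OF s] embedding_inverse[OF t]
    by simp
  then have "Q_adjoin \<alpha> \<subseteq> ?E"
    using eq self_in_Q_adjoin by (intro Q_adjoin_subset) auto
  moreover have "\<sigma> \<in> extensional (Q_adjoin \<alpha>)" "\<tau> \<in> extensional (Q_adjoin \<alpha>)"
    using s t unfolding embeddings_def by blast+
  ultimately show ?thesis
    by (intro extensionalityI) auto
qed

abbreviation ipoly :: "int poly \<Rightarrow> complex \<Rightarrow> complex" where
  "ipoly p z \<equiv> poly (map_poly of_int p) z"

text \<open>Induction along the Horner form; an embedding fixes the integers because it fixes
  1.\<close>

lemma ipoly_embedding:
  assumes s: "\<sigma> \<in> embeddings \<alpha>"
  shows "ipoly p \<alpha> \<in> Q_adjoin \<alpha> \<and> \<sigma> (ipoly p \<alpha>) = ipoly p (\<sigma> \<alpha>)"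
proof (induction p)
  case 0
  then show ?case
    using is_subfield_0[OF is_subfield_Q_adjoin] embedding_0[OF s] by simp
next
  case (pCons a p)
  note K = is_subfield_Q_adjoin[of \<alpha>]
  have hom: "\<sigma> 1 = 1" "\<And>x y. x \<in> Q_adjoin \<alpha> \<Longrightarrow> y \<in> Q_adjoin \<alpha> \<Longrightarrow> \<sigma> (x + y) = \<sigma> x + \<sigma> y \<and> \<sigma> (x * y) = \<sigma> x * \<sigma> y"
    using s unfolding embeddings_def by blast+
  have nat: "of_nat n \<in> Q_adjoin \<alpha> \<and> \<sigma> (of_nat n) = of_nat n" for n
    by (induction n)
       (simp_all add: is_subfield_0[OF K] is_subfield_1[OF K] is_subfield_add[OF K] hom embedding_0[OF s])
  have int: "of_int a \<in> Q_adjoin \<alpha> \<and> \<sigma> (of_int a) = of_int a"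
  proof (cases "a \<ge> 0")
    case True
    then show ?thesis using nat[of "nat a"] by simp
  next
    case False
    then have "complex_of_int a = - of_nat (nat (- a))" by simp
    then show ?thesis
      using nat[of "nat (- a)"] embedding_uminus[OF s] is_subfield_uminus[OF K] by metis
  qed
  have ev: "ipoly (pCons a p) x = of_int a + x * ipoly p x" for x
    by (simp add: of_int_hom.map_poly_pCons_hom)
  have mult: "\<alpha> * ipoly p \<alpha> \<in> Q_adjoin \<alpha>" "\<sigma> (\<alpha> * ipoly p \<alpha>) = \<sigma> \<alpha> * ipoly p (\<sigma> \<alpha>)"
    using pCons.IH self_in_Q_adjoin[of \<alpha>] is_subfield_mult[OF K] hom(2) by metis+
  show ?case
    unfolding ev using int mult is_subfield_add[OF K] hom(2) by metis
qed

lemma embedding_in_conjugates: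
  assumes "algebraic \<alpha>" and s: "\<sigma> \<in> embeddings \<alpha>"
  shows "\<sigma> \<alpha> \<in> conjugates \<alpha>"
  using ipoly_embedding[OF s, of "min_zpoly \<alpha>"] conjugate_self[OF assms(1)] embedding_0[OF s]
  by (simp add: conjugates_def)

text \<open>The fractions already form a subfield containing \<alpha>, so minimality of
  \<open>Q_adjoin \<alpha>\<close> applies. Integer coefficients suffice because the denominator
  absorbs those of rational coefficients.\<close>

lemma Q_adjoin_fractionE:
  assumes "x \<in> Q_adjoin \<alpha>"
  obtains p q where "x = ipoly p \<alpha> / ipoly q \<alpha>" "ipoly q \<alpha> \<noteq> 0"
proof -
  let ?F = "{ipoly p \<alpha> / ipoly q \<alpha> | p q. ipoly q \<alpha> \<noteq> 0}"
  have I: "y \<in> ?F" if "y = ipoly p \<alpha> / ipoly q \<alpha>" "ipoly q \<alpha> \<noteq> 0" for y p q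
    using that by blast
  have "is_subfield ?F"
    unfolding is_subfield_def
  proof (intro conjI ballI)
    show "0 \<in> ?F" by (rule I[of _ 0 1]) simp_all
    show "1 \<in> ?F" by (rule I[of _ 1 1]) simp_all
    fix x assume "x \<in> ?F"
    then obtain p q where x: "x = ipoly p \<alpha> / ipoly q \<alpha>" "ipoly q \<alpha> \<noteq> 0" by blast
    show "- x \<in> ?F"
      by (rule I[of _ "- p" q]) (use x in \<open>simp_all add: hom_distribs\<close>)
    show "inverse x \<in> ?F"
    proof (cases "ipoly p \<alpha> = 0")
      case True
      then show ?thesis using x by (intro I[of _ 0 1]) simp_all
    next
      case False
      then show ?thesis using x by (intro I[of _ q p]) simp_all
    qed
    fix y assume "y \<in> ?F"
    then obtain r s where y: "y = ipoly r \<alpha> / ipoly s \<alpha>" "ipoly s \<alpha> \<noteq> 0" by blast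
    show "x + y \<in> ?F"
      by (rule I[of _ "p * s + r * q" "q * s"]) (use x y in \<open>simp_all add: hom_distribs add_frac_eq\<close>)
    show "x * y \<in> ?F"
      by (rule I[of _ "p * r" "q * s"]) (use x y in \<open>simp_all add: hom_distribs\<close>)
  qed
  moreover have "\<alpha> \<in> ?F"
    by (rule I[of _ "[:0, 1:]" 1]) (simp_all add: map_poly_pCons)
  ultimately have "x \<in> ?F"
    using Q_adjoin_subset assms by blast
  then show thesis using that by blast
qed

text \<open>The map sends \<open>ipoly p \<alpha> / ipoly q \<alpha>\<close> to
  \<open>ipoly p z / ipoly q z\<close>; it is well defined because \<alpha> and \<open>z\<close> are
  roots of the same integer polynomials.\<close>

lemma conjugate_embedding:
  assumes alg: "algebraic \<alpha>" and z: "z \<in> conjugates \<alpha>"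
  obtains \<sigma> where "\<sigma> \<in> embeddings \<alpha>" "\<sigma> \<alpha> = z"
proof -
  note zero = poly_conjugate_eq_0_iff[OF alg z]
  \<comment> \<open>The graph of the map is defined first and shown to be single-valued.\<close>
  define P where "P x y \<longleftrightarrow> (\<exists>p q. x = ipoly p \<alpha> / ipoly q \<alpha> \<and> ipoly q \<alpha> \<noteq> 0 \<and> y = ipoly p z / ipoly q z)" for x y
  define \<sigma> where "\<sigma> = restrict (\<lambda>x. THE y. P x y) (Q_adjoin \<alpha>)"
  have PI: "P (ipoly p \<alpha> / ipoly q \<alpha>) (ipoly p z / ipoly q z)" if "ipoly q \<alpha> \<noteq> 0" for p q
    using that unfolding P_def by blast
  have uniq: "y = y'" if y: "P x y" and y': "P x y'" for x y y'
  proof -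
    obtain p q where pq: "x = ipoly p \<alpha> / ipoly q \<alpha>" "ipoly q \<alpha> \<noteq> 0" "y = ipoly p z / ipoly q z"
      using y unfolding P_def by blast
    obtain r s where rs: "x = ipoly r \<alpha> / ipoly s \<alpha>" "ipoly s \<alpha> \<noteq> 0" "y' = ipoly r z / ipoly s z"
      using y' unfolding P_def by blast
    \<comment> \<open>Equality of two fractions becomes, by cross-multiplication, a polynomial
      relation that passes from \<alpha> to \<open>z\<close>.\<close>
    have "ipoly (p * s - r * q) \<alpha> = 0"
      using pq rs by (simp add: hom_distribs frac_eq_eq)
    then have "ipoly (p * s - r * q) z = 0" by (simp only: zero)
    then show ?thesis
      using pq rs zero[of q] zero[of s] by (simp add: hom_distribs frac_eq_eq)
  qed
  have val: "\<sigma> x = y" if "x \<in> Q_adjoin \<alpha>" "P x y" for x y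
    using that uniq unfolding \<sigma>_def by (auto intro!: the_equality)
  have ex: "\<exists>p q. x = ipoly p \<alpha> / ipoly q \<alpha> \<and> ipoly q \<alpha> \<noteq> 0 \<and> \<sigma> x = ipoly p z / ipoly q z"
    if "x \<in> Q_adjoin \<alpha>" for x
    using Q_adjoin_fractionE[OF that] val[OF that] PI by metis
  note K = is_subfield_Q_adjoin[of \<alpha>]
  have "\<sigma> 1 = 1"
    using PI[of 1 1] by (intro val is_subfield_1[OF K]) simp
  moreover have "\<sigma> (x + y) = \<sigma> x + \<sigma> y" "\<sigma> (x * y) = \<sigma> x * \<sigma> y"
    if xy: "x \<in> Q_adjoin \<alpha>" "y \<in> Q_adjoin \<alpha>" for x y
  proof -
    obtain p q where x: "x = ipoly p \<alpha> / ipoly q \<alpha>" "ipoly q \<alpha> \<noteq> 0" "\<sigma> x = ipoly p z / ipoly q z"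
      using ex[OF xy(1)] by blast
    obtain r s where y: "y = ipoly r \<alpha> / ipoly s \<alpha>" "ipoly s \<alpha> \<noteq> 0" "\<sigma> y = ipoly r z / ipoly s z"
      using ex[OF xy(2)] by blast
    have "P (x + y) (\<sigma> x + \<sigma> y)"
      using PI[of "q * s" "p * s + r * q"] x y zero[of q] zero[of s] by (simp add: hom_distribs add_frac_eq)
    then show "\<sigma> (x + y) = \<sigma> x + \<sigma> y"
      by (intro val is_subfield_add[OF K] xy)
    have "P (x * y) (\<sigma> x * \<sigma> y)"
      using PI[of "q * s" "p * r"] x y by (simp add: hom_distribs)
    then show "\<sigma> (x * y) = \<sigma> x * \<sigma> y"
      by (intro val is_subfield_mult[OF K] xy)
  qed
  moreover have "\<sigma> \<in> extensional (Q_adjoin \<alpha>)"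
    by (simp add: \<sigma>_def)
  ultimately have "\<sigma> \<in> embeddings \<alpha>"
    unfolding embeddings_def by blast
  moreover have "\<sigma> \<alpha> = z"
    using PI[of 1 "[:0, 1:]"] by (intro val self_in_Q_adjoin) (simp add: map_poly_pCons)
  ultimately show thesis by (rule that)
qed

lemma bij_betw_embeddings_conjugates:
  assumes "algebraic \<alpha>"
  shows "bij_betw (\<lambda>\<sigma>. \<sigma> \<alpha>) (embeddings \<alpha>) (conjugates \<alpha>)"
  unfolding bij_betw_def
proof (intro conjI subset_antisym subsetI)
  show "inj_on (\<lambda>\<sigma>. \<sigma> \<alpha>) (embeddings \<alpha>)"
    using embeddings_eqI by (auto intro!: inj_onI)
  show "z \<in> (\<lambda>\<sigma>. \<sigma> \<alpha>) ` embeddings \<alpha>" if "z \<in> conjugates \<alpha>" for z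
    using conjugate_embedding[OF assms that] by blast
qed (use embedding_in_conjugates[OF assms] in auto)

text \<open>\<open>measure_of\<close> takes the intended values only for a countably additive set
  function; agreement with a pushforward of the uniform measure on the conjugates supplies this and
  reduces integrals to finite sums.\<close>

lemma conj_measure_eq_distr:
  assumes int: "algebraic_int \<alpha>" and nz: "\<alpha> \<noteq> 0"
  shows "conj_measure \<alpha> = distr (uniform_count_measure (conjugates \<alpha>)) punctured_plane (\<lambda>z. z)"
proof -
  let ?C = "conjugates \<alpha>" and ?E = "embeddings \<alpha>" and ?P = punctured_plane
  let ?N = "distr (uniform_count_measure ?C) ?P (\<lambda>z. z)"
  have alg: "algebraic \<alpha>" using int by auto
  have fin: "finite ?C" by (rule finite_conjugates[OF alg])
  have meas: "(\<lambda>z. z) \<in> measurable (uniform_count_measure ?C) ?P"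
    using conjugate_nonzero[OF alg nz]
    by (auto simp: measurable_def space_uniform_count_measure sets_uniform_count_measure space_restrict_space)
  have eq: "ennreal (1 / real (alg_deg \<alpha>)) * (\<Sum>\<sigma>\<in>?E. emeasure (return ?P (\<sigma> \<alpha>)) A) = emeasure ?N A"
    if A: "A \<in> sets ?P" for A
  proof -
    have "(\<Sum>\<sigma>\<in>?E. emeasure (return ?P (\<sigma> \<alpha>)) A) = (\<Sum>z\<in>?C. emeasure (return ?P z) A)"
      by (rule sum.reindex_bij_betw[OF bij_betw_embeddings_conjugates[OF alg]])
    also have "\<dots> = (\<Sum>z\<in>?C. indicator A z)"
      using A by simp
    also have "\<dots> = of_nat (card (?C \<inter> A))"
      using fin by (simp add: indicator_def sum.If_cases Int_def)
    finally have "ennreal (1 / real (alg_deg \<alpha>)) * (\<Sum>\<sigma>\<in>?E. emeasure (return ?P (\<sigma> \<alpha>)) A)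
        = ennreal (1 / real (alg_deg \<alpha>)) * ennreal (real (card (?C \<inter> A)))"
      by (simp add: ennreal_of_nat_eq_real_of_nat)
    also have "\<dots> = ennreal (real (card (?C \<inter> A)) / real (card ?C))"
      by (simp add: card_conjugates[OF int] flip: ennreal_mult)
    also have "\<dots> = emeasure (uniform_count_measure ?C) (?C \<inter> A)"
      using fin by (subst emeasure_uniform_count_measure) auto
    also have "\<dots> = emeasure ?N A"
      using A by (subst emeasure_distr[OF meas]) (auto simp: space_uniform_count_measure Int_commute)
    finally show ?thesis .
  qed
  have "conj_measure \<alpha> = measure_of (space ?P) (sets ?P) (emeasure ?N)"
    unfolding conj_measure_def
    by (intro measure_of_eq sets.space_closed eq) (simp only: sets.sigma_sets_eq)
  also have "\<dots> = measure_of (space ?N) (sets ?N) (emeasure ?N)"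
    by simp
  also have "\<dots> = ?N" by (rule measure_of_of_measure)
  finally show ?thesis .
qed

lemma integral_conj_measure:
  fixes f :: "complex \<Rightarrow> complex"
  assumes int: "algebraic_int \<alpha>" and nz: "\<alpha> \<noteq> 0" and f: "f \<in> borel_measurable punctured_plane"
  shows "(\<integral>z. f z \<partial>conj_measure \<alpha>) = (\<Sum>z\<in>conjugates \<alpha>. f z) / of_nat (card (conjugates \<alpha>))"
proof -
  have alg: "algebraic \<alpha>" using int by auto
  have "(\<lambda>z. z) \<in> measurable (uniform_count_measure (conjugates \<alpha>)) punctured_plane"
    using conjugate_nonzero[OF alg nz]
    by (auto simp: measurable_def space_uniform_count_measure sets_uniform_count_measure space_restrict_space)
  then have "(\<integral>z. f z \<partial>conj_measure \<alpha>) = (\<integral>z. f z \<partial>uniform_count_measure (conjugates \<alpha>))"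
    unfolding conj_measure_eq_distr[OF int nz] using f by (rule integral_distr)
  also have "\<dots> = (\<Sum>z\<in>conjugates \<alpha>. f z /\<^sub>R real (card (conjugates \<alpha>)))"
    unfolding uniform_count_measure_def
    by (subst lebesgue_integral_point_measure_finite)
       (auto simp: finite_conjugates[OF alg] inverse_eq_divide)
  finally show ?thesis
    by (simp add: scaleR_conv_of_real divide_inverse mult.commute sum_distrib_right)
qed

section \<open>Strictness and convergence\<close>

lemma norm_le_house:
  assumes "algebraic \<alpha>" "z \<in> conjugates \<alpha>"
  shows "cmod z \<le> house \<alpha>"
  unfolding house_def using assms finite_conjugates by (intro Max_ge) auto

lemma house_eq_if_min_zpoly_eq: "min_zpoly \<alpha> = min_zpoly \<beta> \<Longrightarrow> house \<alpha> = house \<beta>"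
  by (simp add: house_def conjugates_def)

text \<open>Bounded degree and Mahler measure leave finitely many minimal polynomials, hence
  finitely many houses. All of these exceed 1, so a sequence of houses tending to 1 eventually
  avoids them.\<close>

lemma alg_deg_tendsto_infinity:
  fixes a :: "nat \<Rightarrow> complex"
  assumes alg: "\<And>q. algebraic (a q)" and gt: "\<And>q. cmod (a q) > 1" and mahler: "\<And>q. mahler (a q) \<le> B"
    and lim: "(\<lambda>q. house (a q)) \<longlonglongrightarrow> 1"
  shows "filterlim (\<lambda>q. alg_deg (a q)) at_top sequentially"
  unfolding filterlim_at_top
proof
  fix d
  define Q where "Q = {q. alg_deg (a q) \<le> d}"
  have "(\<lambda>q. min_zpoly (a q)) ` Q \<subseteq> {p. Polynomial.degree p \<le> d \<and> mahler_measure p \<le> B}"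
    using mahler by (auto simp: Q_def alg_deg_def mahler_def)
  then have "finite ((\<lambda>q. min_zpoly (a q)) ` Q)"
    using finite_int_poly_mahler_bounded finite_subset by blast
  \<comment> \<open>\<open>T\<close> picks finitely many indices that represent all minimal
    polynomials of degree at most \<open>d\<close> in the sequence.\<close>
  then obtain T where T: "finite T" "T \<subseteq> Q" "(\<lambda>q. min_zpoly (a q)) ` Q = (\<lambda>q. min_zpoly (a q)) ` T"
    by (meson finite_subset_image subset_refl)
  have "\<forall>\<^sub>F q in sequentially. \<forall>t\<in>T. house (a q) < house (a t)"
  proof (intro eventually_ball_finite T(1) ballI)
    fix t
    have "1 < house (a t)"
      using gt[of t] norm_le_house[OF alg conjugate_self[OF alg], of t] by linarith
    then show "\<forall>\<^sub>F q in sequentially. house (a q) < house (a t)"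
      by (rule order_tendstoD(2)[OF lim])
  qed
  then show "\<forall>\<^sub>F q in sequentially. d \<le> alg_deg (a q)"
  proof eventually_elim
    case (elim q)
    show ?case
    proof (rule ccontr)
      assume "\<not> d \<le> alg_deg (a q)"
      then have "min_zpoly (a q) \<in> (\<lambda>q. min_zpoly (a q)) ` T"
        using T(3) by (auto simp: Q_def)
      then obtain t where "t \<in> T" "min_zpoly (a q) = min_zpoly (a t)"
        by auto
      then show False
        using elim house_eq_if_min_zpoly_eq[of "a q" "a t"] by auto
    qed
  qed
qed

text \<open>All powers of \<open>z\<close> lie in \<open>H\<close>, hence are roots of one nonzero
  polynomial; for modulus above 1 they would be pairwise distinct.\<close>

lemma proper_algebraic_subgroup_norm_le_1:
  assumes H: "algebraic_subgroup H" "H \<noteq> carrier Qbar_units" and z: "z \<in> H"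
  shows "cmod z \<le> 1"
proof (rule ccontr)
  assume "\<not> cmod z \<le> 1"
  then have z1: "cmod z > 1" by simp
  interpret subgroup H Qbar_units
    using H(1) by (simp add: algebraic_subgroup_def)
  obtain P where P: "H = {z \<in> carrier Qbar_units. \<forall>p\<in>P. poly p z = 0}"
    using H(1) by (auto simp: algebraic_subgroup_def)
  \<comment> \<open>The zero polynomial imposes no condition, so a proper subgroup needs a nonzero
    equation.\<close>
  have "\<not> P \<subseteq> {0}"
  proof
    assume "P \<subseteq> {0}"
    then have "\<forall>p\<in>P. poly p x = 0" for x
      by (metis poly_0 singletonD subsetD)
    then have "H = carrier Qbar_units"
      unfolding P by blast
    with H(2) show False ..
  qed
  then obtain p where p: "p \<in> P" "p \<noteq> 0"
    by blast
  have pow: "z ^ k \<in> H" for k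
  proof (induction k)
    case 0
    then show ?case using one_closed by (simp add: Qbar_units_def)
  next
    case (Suc k)
    then show ?case using m_closed[OF z Suc] by (simp add: Qbar_units_def)
  qed
  have "inj (\<lambda>k. z ^ k)"
  proof (rule injI)
    fix i j assume "z ^ i = z ^ j"
    then have "cmod z ^ i = cmod z ^ j" by (metis norm_power)
    then show "i = j" using z1 by (simp add: power_inject_exp)
  qed
  moreover have "range (\<lambda>k. z ^ k) \<subseteq> {x. poly p x = 0}"
  proof clarify
    show "poly p (z ^ k) = 0" for k
      using pow[of k] p(1) unfolding P by blast
  qed
  ultimately show False
    using poly_roots_finite[OF p(2)] finite_subset range_inj_infinite by blast
qed

text \<open>The finitely many indices up to \<open>N\<close> have bounded values under
  \<open>g\<close>, so a value beyond that bound forces a large index. Convergence in the index thus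
  implies convergence as \<open>g\<close> tends to infinity.\<close>

lemma filtercomap_at_top_le_sequentially:
  fixes g :: "nat \<Rightarrow> nat"
  shows "filtercomap g at_top \<le> sequentially"
proof (rule filter_leI)
  fix P assume "eventually P sequentially"
  then obtain N where N: "\<And>q. q \<ge> N \<Longrightarrow> P q"
    by (auto simp: eventually_sequentially)
  define K where "K = Suc (Max (g ` {..N}))"
  have "P q" if "g q \<ge> K" for q
  proof (rule N, rule ccontr)
    assume "\<not> N \<le> q"
    then have "g q \<le> Max (g ` {..N})" by (intro Max_ge) auto
    then show False using that by (simp add: K_def)
  qed
  then show "eventually P (filtercomap g at_top)"
    by (auto simp: eventually_filtercomap eventually_at_top_linorder)
qed

theorem theorem1p6:
  fixes \<alpha> :: "nat \<Rightarrow> complex"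
  assumes "\<And>q. q \<ge> 1 \<Longrightarrow> algebraic_int (\<alpha> q)"
    and "\<And>q. q \<ge> 1 \<Longrightarrow> cmod (\<alpha> q) > 1"
    and "\<And>q. q \<ge> 1 \<Longrightarrow> mahler (\<alpha> q) < lehmer_number"
    and "\<And>q. q \<ge> 1 \<Longrightarrow> dyg (\<alpha> q) \<ge> 260"
    and "\<And>q. q \<ge> 1 \<Longrightarrow>
           \<not> (\<exists>(r::nat) (Q::int poly). r \<ge> 2 \<and> min_zpoly (\<alpha> q) = pcompose Q (Polynomial.monom 1 r))"
    and "(\<lambda>q. house (\<alpha> q)) \<longlonglongrightarrow> 1"
  shows "strict_sequence \<alpha> \<and>
    (\<forall>f :: complex \<Rightarrow> complex.
       continuous_on (- {0}) f \<and> bounded (f ` (- {0})) \<longrightarrow>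
       ((\<lambda>q. \<integral>z. f z \<partial>conj_measure (\<alpha> q)) \<longlongrightarrow> (\<integral>z. f z \<partial>circle_haar))
         (filtercomap (\<lambda>q. dyg (\<alpha> q)) at_top))"
proof (intro conjI allI impI)
  have alg: "algebraic (\<alpha> q)" if "q \<ge> 1" for q
    using assms(1)[OF that] by auto
  have nz: "\<alpha> q \<noteq> 0" if "q \<ge> 1" for q
    using assms(2)[OF that] by auto
  show "strict_sequence \<alpha>"
    unfolding strict_sequence_def
  proof (intro conjI allI impI)
    show "\<alpha> q \<in> carrier Qbar_units" if "q \<ge> 1" for q
      using alg[OF that] nz[OF that] by (simp add: Qbar_units_def)
    fix H assume "algebraic_subgroup H \<and> H \<noteq> carrier Qbar_units"
    then have "\<alpha> q \<notin> H" if "q \<ge> 1" for q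
      using proper_algebraic_subgroup_norm_le_1[of H "\<alpha> q"] assms(2)[OF that] by auto
    then have "{q. q \<ge> 1 \<and> \<alpha> q \<in> H} = {}"
      by blast
    then show "finite {q. q \<ge> 1 \<and> \<alpha> q \<in> H}"
      by (simp only: finite.emptyI)
  qed
  \<comment> \<open>The hypotheses start at index 1, while the locale speaks of every index; the
    shift is undone at the end by \<open>LIMSEQ_imp_Suc\<close>.\<close>
  define a where "a q = \<alpha> (Suc q)" for q
  have a: "algebraic_int (a q)" "algebraic (a q)" "cmod (a q) > 1" "a q \<noteq> 0" "mahler (a q) \<le> lehmer_number" for q
    using assms(1,2,3)[of "Suc q"] alg[of "Suc q"] nz[of "Suc q"] by (auto simp: a_def)
  have lim: "(\<lambda>q. house (a q)) \<longlonglongrightarrow> 1"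
    unfolding a_def using assms(6) by (rule LIMSEQ_Suc)
  interpret near_circle_sets "\<lambda>q. conjugates (a q)" "\<lambda>q. house (a q)"
  proof
    fix q
    show "finite (conjugates (a q))" by (intro finite_conjugates a)
    show "conjugates (a q) \<noteq> {}" using conjugate_self[OF a(2)] by blast
    show "z \<noteq> 0" if "z \<in> conjugates (a q)" for z
      using conjugate_nonzero[OF a(2,4) that] .
    show "cmod z \<le> house (a q)" if "z \<in> conjugates (a q)" for z
      using norm_le_house[OF a(2) that] .
    show "1 \<le> house (a q)"
      using norm_le_house[OF a(2) conjugate_self[OF a(2)], of q] a(3)[of q] by linarith
    show "0 \<le> (\<Sum>z\<in>conjugates (a q). ln (cmod z))"
      by (intro sum_ln_norm_conjugates_nonneg a)
    show "0 \<le> (\<Sum>z\<in>conjugates (a q). \<Sum>w\<in>conjugates (a q) - {z}. ln (cmod (z - w)))"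
      by (intro sum_ln_dist_conjugates_nonneg a)
  next
    show "filterlim (\<lambda>q. card (conjugates (a q))) at_top sequentially"
      using alg_deg_tendsto_infinity[OF a(2,3,5) lim] by (simp add: card_conjugates[OF a(1)])
  qed (rule lim)
  fix f :: "complex \<Rightarrow> complex"
  assume f: "continuous_on (- {0}) f \<and> bounded (f ` (- {0}))"
  have "(\<integral>z. f z \<partial>conj_measure (a q)) = mean q f" for q
    unfolding mean_def using f by (intro integral_conj_measure a borel_measurable_punctured_plane) auto
  then have "(\<lambda>q. \<integral>z. f z \<partial>conj_measure (\<alpha> (Suc q))) \<longlonglongrightarrow> (\<integral>z. f z \<partial>circle_haar)"
    using mean_tendsto_circle_haar f by (simp add: a_def)
  then have "(\<lambda>q. \<integral>z. f z \<partial>conj_measure (\<alpha> q)) \<longlonglongrightarrow> (\<integral>z. f z \<partial>circle_haar)"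
    by (rule LIMSEQ_imp_Suc)
  then show "((\<lambda>q. \<integral>z. f z \<partial>conj_measure (\<alpha> q)) \<longlongrightarrow> (\<integral>z. f z \<partial>circle_haar))
      (filtercomap (\<lambda>q. dyg (\<alpha> q)) at_top)"
    by (rule tendsto_mono[OF filtercomap_at_top_le_sequentially])
qed

end
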